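(* Let $G$ be a finitely generated partially commutative group with canonical generating set $X$. Then $\mathrm{cdim}(G)$ equals the height of the lattice $\mathfrak{C}(X;G)$ of canonical centralisers, i.e. $\mathrm{cdim}(G)$ is the largest integer $k$ for which there exist subsets $Y_0,Y_1,\dots,Y_k\subseteq X$ with $C(Y_0)>C(Y_1)>\cdots>C(Y_k)$.
   Context: Let $\Gamma$ be a finite simple undirected graph with vertex set $X$, and let $G=G(\Gamma)=\langle X\mid [x,y]=1 \text{ whenever } x,y \text{ are joined by an edge of }\Gamma\rangle$ be the (free) partially commutative group with commutation graph $\Gamma$. For $S\subseteq G$, $C(S)$ is the centraliser of $S$ in $G$; a centraliser is a subgroup of the form $C(S)$, and a canonical centraliser is one of the form $C(Y)$ with $Y\subseteq X$; $\mathfrak{C}(X;G)$ is the set of canonical centralisers ordered by inclusion. A centraliser chain of length $k$ is a sequence of centralisers $C_0>C_1>\cdots>C_k$ with strict inclusions. The centraliser dimension $\mathrm{cdim}(G)$ of a group $G$ is the maximal length of a centraliser chain in $G$ (and $\infty$ if there is no maximum); for partially commutative groups it is finite. *)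

theory Defs
  imports "HOL-Algebra.Group" "HOL-Library.Extended_Nat"
begin

text \<open>Words over the alphabet X^{+-1}: a letter is (x, True) for x and (x, False) for x^-1.
  One-step relation: free cancellation of x x^-1 / x^-1 x (x in X), and swapping two
  adjacent letters whose underlying generators are joined by an edge of the graph E.\<close>

inductive pc_step :: "'a set \<Rightarrow> ('a \<Rightarrow> 'a \<Rightarrow> bool) \<Rightarrow> ('a \<times> bool) list \<Rightarrow> ('a \<times> bool) list \<Rightarrow> bool"
  for X E where
  cancel: "x \<in> X \<Longrightarrow> pc_step X E (xs @ [(x, b), (x, \<not> b)] @ ys) (xs @ ys)"
| comm: "E x y \<Longrightarrow> pc_step X E (xs @ [(x, b), (y, c)] @ ys) (xs @ [(y, c), (x, b)] @ ys)"

definition pc_equiv :: "'a set \<Rightarrow> ('a \<Rightarrow> 'a \<Rightarrow> bool) \<Rightarrow> ('a \<times> bool) list \<Rightarrow> ('a \<times> bool) list \<Rightarrow> bool" where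
  "pc_equiv X E = (sup (pc_step X E) (conversep (pc_step X E)))\<^sup>*\<^sup>*"

definition pc_class :: "'a set \<Rightarrow> ('a \<Rightarrow> 'a \<Rightarrow> bool) \<Rightarrow> ('a \<times> bool) list \<Rightarrow> ('a \<times> bool) list set" where
  "pc_class X E w = {v. pc_equiv X E w v}"

definition pc_words :: "'a set \<Rightarrow> ('a \<times> bool) list set" where
  "pc_words X = {w. set w \<subseteq> X \<times> UNIV}"

definition pc_group :: "'a set \<Rightarrow> ('a \<Rightarrow> 'a \<Rightarrow> bool) \<Rightarrow> ('a \<times> bool) list set monoid" where
  "pc_group X E = \<lparr> carrier = pc_class X E ` pc_words X,
     mult = (\<lambda>A B. {v. \<exists>a\<in>A. \<exists>b\<in>B. pc_equiv X E (a @ b) v}),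
     one = pc_class X E [] \<rparr>"

definition pc_gen :: "'a set \<Rightarrow> ('a \<Rightarrow> 'a \<Rightarrow> bool) \<Rightarrow> 'a \<Rightarrow> ('a \<times> bool) list set" where
  "pc_gen X E x = pc_class X E [(x, True)]"

definition centraliser :: "('g, 'b) monoid_scheme \<Rightarrow> 'g set \<Rightarrow> 'g set" where
  "centraliser G S = {g \<in> carrier G. \<forall>s\<in>S. g \<otimes>\<^bsub>G\<^esub> s = s \<otimes>\<^bsub>G\<^esub> g}"

definition is_centraliser :: "('g, 'b) monoid_scheme \<Rightarrow> 'g set \<Rightarrow> bool" where
  "is_centraliser G H \<longleftrightarrow> (\<exists>S \<subseteq> carrier G. H = centraliser G S)"

definition centraliser_chain :: "('g, 'b) monoid_scheme \<Rightarrow> (nat \<Rightarrow> 'g set) \<Rightarrow> nat \<Rightarrow> bool" where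
  "centraliser_chain G C k \<longleftrightarrow>
     (\<forall>i\<le>k. is_centraliser G (C i)) \<and> (\<forall>i<k. C (Suc i) \<subset> C i)"

definition cdim :: "('g, 'b) monoid_scheme \<Rightarrow> enat" where
  "cdim G = Sup {enat k | k. \<exists>C. centraliser_chain G C k}"

end

theory Submission
  imports Defs
begin

text \<open>A strictly descending chain of \<open>k + 1\<close> centralisers amounts to a ladder of length \<open>k\<close>: pairs
  \<open>(g\<^sub>i, h\<^sub>i)\<close> such that \<open>h\<^sub>j\<close> commutes with \<open>g\<^sub>i\<close> for \<open>i < j\<close>, but \<open>h\<^sub>i\<close> does not commute with
  \<open>g\<^sub>i\<close>. So a ladder in the group has to be turned into a ladder of generators of the same length.
  By induction on \<open>T \<subseteq> X\<close> this is done for ladders with all \<open>h\<^sub>i\<close> in the parabolic subgroup \<open>G(T)\<close>, by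
  looking at the first element \<open>g\<close> of the ladder.

  If \<open>G(T) \<inter> C(g)\<close> is conjugate in \<open>G(T)\<close> into some \<open>G(T \<inter> C(y))\<close> with \<open>T \<inter> C(y) \<noteq> T\<close>, then the pair
  \<open>(y, t)\<close> with \<open>t \<in> T - C(y)\<close> replaces \<open>(g, h)\<close>. Otherwise \<open>g\<close> may be taken in \<open>G(T)\<close> and cyclically
  reduced. If the letters of \<open>g\<close> commute pairwise, then again \<open>G(T) \<inter> C(g) \<subseteq> G(T \<inter> C(p))\<close> for a letter \<open>p\<close>
  of \<open>g\<close>. If \<open>g\<close> has letters \<open>p\<close>, \<open>q\<close> that do not commute, then every element of \<open>C(g)\<close> has a power in
  \<open>G(T \<inter> C(p) \<inter> C(q)) \<langle>g\<rangle>\<close>. Since elements with commuting powers commute, the ladder can be pushed into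
  \<open>G(T \<inter> C(p) \<inter> C(q))\<close> at the cost of one more pair, and the two lost pairs are replaced by \<open>(p, q)\<close>
  and \<open>(q, p)\<close>.\<close>

section \<open>Words\<close>

definition linv :: "'a \<times> bool \<Rightarrow> 'a \<times> bool" where
  "linv l = (fst l, \<not> snd l)"

definition winv :: "('a \<times> bool) list \<Rightarrow> ('a \<times> bool) list" where
  "winv w = rev (map linv w)"

text \<open>Projections to pairs of non-adjacent generators embed the partially commutative monoid
  into a product of free monoids. The case \<open>x = y\<close> is included because a generator
  adjacent to all others lies in no pair of distinct non-adjacent generators.\<close>

definition proj :: "'a \<Rightarrow> 'a \<Rightarrow> ('a \<times> bool) list \<Rightarrow> ('a \<times> bool) list" where
  "proj x y w = filter (\<lambda>l. fst l = x \<or> fst l = y) w"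

definition wpow :: "'b list \<Rightarrow> nat \<Rightarrow> 'b list" where
  "wpow w n = concat (replicate n w)"

definition supp :: "('a \<times> bool) list \<Rightarrow> 'a set" where
  "supp w = fst ` set w"

lemma fst_linv [simp]: "fst (linv a) = fst a"
  and linv_linv [simp]: "linv (linv a) = a"
  and linv_neq [simp]: "linv a \<noteq> a" "a \<noteq> linv a"
  by (cases a; simp add: linv_def)+

lemma winv_simps [simp]:
  "winv [] = []" "winv (u @ v) = winv v @ winv u" "winv (winv u) = u"
  "winv (a # u) = winv u @ [linv a]" "length (winv u) = length u"
  by (auto simp: winv_def rev_map comp_def)

lemma proj_simps [simp]:
  "proj x y [] = []" "proj x y (u @ v) = proj x y u @ proj x y v"
  "proj x y (a # u) = (if fst a = x \<or> fst a = y then a # proj x y u else proj x y u)"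
  by (auto simp: proj_def)

lemma proj_empty: "x \<notin> supp w \<Longrightarrow> y \<notin> supp w \<Longrightarrow> proj x y w = []"
  by (auto simp: proj_def supp_def filter_empty_conv)

lemma proj_winv: "proj x y (winv w) = winv (proj x y w)"
  by (induction w) auto

lemma wpow_simps [simp]: "wpow w 0 = []" "wpow w (Suc n) = w @ wpow w n"
  by (auto simp: wpow_def)

lemma wpow_add: "wpow w (m + n) = wpow w m @ wpow w n"
  by (simp add: wpow_def replicate_add)

lemma wpow_snoc: "wpow w (Suc n) = wpow w n @ w"
  using wpow_add[of w n 1] by simp

lemma length_wpow [simp]: "length (wpow w n) = n * length w"
  by (induction n) auto

lemma proj_wpow: "proj x y (wpow w n) = wpow (proj x y w) n"
  by (induction n) auto

lemma winv_wpow: "winv (wpow w n) = wpow (winv w) n"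
proof (induction n)
  case (Suc n)
  then have "winv (wpow w (Suc n)) = wpow (winv w) n @ winv w" by simp
  then show ?case by (metis wpow_snoc)
qed simp

lemma supp_simps [simp]:
  "supp [] = {}" "supp (u @ v) = supp u \<union> supp v" "supp (a # u) = insert (fst a) (supp u)"
  "supp (winv u) = supp u"
  by (auto simp: supp_def winv_def image_image)

lemma supp_wpow: "supp (wpow w n) \<subseteq> supp w"
  by (induction n) auto

text \<open>Equal powers have equal length, so the two bases are prefixes of the same length of one
  word.\<close>

lemma wpow_inject: "wpow u n = wpow v n \<Longrightarrow> n > 0 \<Longrightarrow> u = v"
  by (metis append_eq_append_conv gr0_implies_Suc length_wpow mult_cancel1 not_gr0 wpow_simps(2))

lemma wpow_commute:
  assumes "u @ v = v @ u"
  shows "wpow u m @ wpow v n = wpow v n @ wpow u m"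
proof -
  have *: "u @ wpow v n = wpow v n @ u" for n
  proof (induction n)
    case (Suc n)
    have "u @ wpow v (Suc n) = v @ u @ wpow v n" using assms by (metis append.assoc wpow_simps(2))
    then show ?case using Suc by simp
  qed simp
  show ?thesis
  proof (induction m)
    case (Suc m)
    have "wpow u (Suc m) @ wpow v n = u @ wpow v n @ wpow u m" using Suc by simp
    also have "\<dots> = wpow v n @ wpow u (Suc m)" using * by (metis append.assoc wpow_simps(2))
    finally show ?case .
  qed simp
qed

lemma pc_step_context: "pc_step X E u v \<Longrightarrow> pc_step X E (p @ u @ q) (p @ v @ q)"
proof (induction rule: pc_step.induct)
  case (cancel x xs b ys)
  then show ?case using pc_step.cancel[of x X E "p @ xs" b "ys @ q"] by simp
next
  case (comm x y xs b c ys)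
  then show ?case using pc_step.comm[of E x y X "p @ xs" b c "ys @ q"] by simp
qed

text \<open>A generator and its inverse are counted together and without sign, so the count vanishes
  only if \<open>x\<close> does not occur.\<close>

definition cnt :: "'a \<Rightarrow> ('a \<times> bool) list \<Rightarrow> nat" where
  "cnt x w = length (proj x x w)"

lemma cnt_simps [simp]: "cnt x [] = 0" "cnt x (u @ v) = cnt x u + cnt x v"
  by (auto simp: cnt_def)

lemma cnt_wpow [simp]: "cnt x (wpow w n) = n * cnt x w"
  by (induction n) auto

lemma cnt_proj [simp]: "cnt x (proj x y w) = cnt x w" "cnt y (proj x y w) = cnt y w"
proof -
  have "cnt x (proj x y w) = cnt x w \<and> cnt y (proj x y w) = cnt y w"
    by (induction w) (auto simp: cnt_def)
  then show "cnt x (proj x y w) = cnt x w" "cnt y (proj x y w) = cnt y w" by auto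
qed

lemma cnt_pos_iff: "cnt x w > 0 \<longleftrightarrow> x \<in> supp w"
  by (auto simp: cnt_def proj_def supp_def filter_empty_conv)

lemma length_proj: "x \<noteq> y \<Longrightarrow> length (proj x y w) = cnt x w + cnt y w"
  by (induction w) (auto simp: cnt_def)

text \<open>Commuting words of a free monoid are powers of a common word, so their letter counts are
  proportional.\<close>

lemma proj_commute_cnt:
  assumes "u @ v = v @ u"
  shows "cnt x u * cnt y v = cnt y u * cnt x v"
proof -
  obtain m n z where "wpow z m = u" "wpow z n = v"
    using comm_append_are_replicate[OF assms] unfolding wpow_def by blast
  then show ?thesis by auto
qed

section \<open>Ladders of centralisers\<close>

text \<open>Kept abstract in \<open>R\<close> so that one notion serves group elements (second entry
  in the centraliser of the first) and generators (equal or adjacent).\<close>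

definition ladder :: "('g \<Rightarrow> 'h \<Rightarrow> bool) \<Rightarrow> ('g \<times> 'h) list \<Rightarrow> bool" where
  "ladder R L \<longleftrightarrow> sorted_wrt (\<lambda>p q. R (fst p) (snd q)) L \<and> (\<forall>p\<in>set L. \<not> R (fst p) (snd p))"

lemma ladder_Nil [simp]: "ladder R []"
  by (simp add: ladder_def)

lemma ladder_Cons [simp]:
  "ladder R (p # L) \<longleftrightarrow> \<not> R (fst p) (snd p) \<and> (\<forall>q\<in>set L. R (fst p) (snd q)) \<and> ladder R L"
  by (auto simp: ladder_def)

lemma ladder_append:
  "ladder R (L @ M) \<longleftrightarrow> ladder R L \<and> ladder R M \<and> (\<forall>p\<in>set L. \<forall>q\<in>set M. R (fst p) (snd q))"
  by (auto simp: ladder_def sorted_wrt_append)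

lemma ladder_map:
  assumes "ladder R L"
    and "\<And>p q. p \<in> set L \<Longrightarrow> q \<in> set L \<Longrightarrow> R (fst p) (snd q) \<longleftrightarrow> R' (fst (f p)) (snd (f q))"
  shows "ladder R' (map f L)"
  using assms unfolding ladder_def sorted_wrt_map
  by (auto intro: sorted_wrt_mono_rel[rotated])

lemma ladder_nth:
  "ladder R L \<longleftrightarrow> (\<forall>i j. i < j \<longrightarrow> j < length L \<longrightarrow> R (fst (L ! i)) (snd (L ! j))) \<and>
    (\<forall>i<length L. \<not> R (fst (L ! i)) (snd (L ! i)))"
  by (auto simp: ladder_def sorted_wrt_iff_nth_less all_set_conv_all_nth)

section \<open>Centralisers and conjugation in an arbitrary group\<close>

lemma (in group) subgroup_nat_pow: "subgroup H G \<Longrightarrow> x \<in> H \<Longrightarrow> x [^] (n::nat) \<in> H"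
  by (induction n) (auto simp: subgroup.one_closed subgroup.m_closed)

lemma (in group) subgroup_int_pow: "subgroup H G \<Longrightarrow> x \<in> H \<Longrightarrow> x [^] (i::int) \<in> H"
  unfolding int_pow_def2 by (metis subgroup_nat_pow subgroup.m_inv_closed)

lemma centraliser_pointwise:
  "h \<in> centraliser G S \<longleftrightarrow> h \<in> carrier G \<and> (\<forall>s\<in>S. h \<in> centraliser G {s})"
  by (auto simp: centraliser_def)

lemma (in group) centraliser_iff: "f \<in> carrier G \<Longrightarrow>
    h \<in> centraliser G {f} \<longleftrightarrow> h \<in> carrier G \<and> h \<otimes> f = f \<otimes> h"
  by (auto simp: centraliser_def)

lemma (in group) centraliser_sym:
  "f \<in> carrier G \<Longrightarrow> h \<in> carrier G \<Longrightarrow> h \<in> centraliser G {f} \<longleftrightarrow> f \<in> centraliser G {h}"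
  by (auto simp: centraliser_iff)

lemma (in group) subgroup_centraliser:
  assumes "S \<subseteq> carrier G"
  shows "subgroup (centraliser G S) G"
proof (rule subgroupI)
  show "centraliser G S \<subseteq> carrier G" by (auto simp: centraliser_def)
  show "centraliser G S \<noteq> {}" using assms by (auto simp: centraliser_def intro!: exI[of _ \<one>])
  fix a assume a: "a \<in> centraliser G S"
  then have ac: "a \<in> carrier G" by (simp add: centraliser_def)
  show "inv a \<in> centraliser G S"
    unfolding centraliser_def
  proof safe
    show "inv a \<in> carrier G" using ac by simp
    fix s assume "s \<in> S"
    then have "s \<in> carrier G" "a \<otimes> s = s \<otimes> a" using a assms by (auto simp: centraliser_def)
    then show "inv a \<otimes> s = s \<otimes> inv a"
      using ac by (metis inv_closed inv_solve_left inv_solve_right m_assoc m_closed)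
  qed
  fix b assume b: "b \<in> centraliser G S"
  then have bc: "b \<in> carrier G" by (simp add: centraliser_def)
  show "a \<otimes> b \<in> centraliser G S"
    unfolding centraliser_def
  proof safe
    show "a \<otimes> b \<in> carrier G" using ac bc by simp
    fix s assume "s \<in> S"
    then have "s \<in> carrier G" "a \<otimes> s = s \<otimes> a" "b \<otimes> s = s \<otimes> b"
      using a b assms by (auto simp: centraliser_def)
    then show "a \<otimes> b \<otimes> s = s \<otimes> (a \<otimes> b)" using ac bc by (metis m_assoc)
  qed
qed

definition (in group) conj_by :: "'a \<Rightarrow> 'a \<Rightarrow> 'a" where
  "conj_by c x = inv c \<otimes> x \<otimes> c"

lemma (in group) conj_closed [simp]: "c \<in> carrier G \<Longrightarrow> x \<in> carrier G \<Longrightarrow> conj_by c x \<in> carrier G"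
  by (simp add: conj_by_def)

lemma (in group) conj_mult:
  assumes "c \<in> carrier G" "x \<in> carrier G" "y \<in> carrier G"
  shows "conj_by c (x \<otimes> y) = conj_by c x \<otimes> conj_by c y"
proof -
  have "conj_by c x \<otimes> conj_by c y = inv c \<otimes> x \<otimes> ((c \<otimes> inv c) \<otimes> (y \<otimes> c))"
    using assms by (simp only: conj_by_def m_assoc m_closed inv_closed)
  then show ?thesis using assms by (simp add: conj_by_def m_assoc)
qed

lemma (in group) conj_pow:
  "c \<in> carrier G \<Longrightarrow> x \<in> carrier G \<Longrightarrow> conj_by c (x [^] (n::nat)) = conj_by c x [^] n"
  by (induction n) (simp_all add: conj_mult, simp add: conj_by_def)

lemma (in group) conj_inj:
  "c \<in> carrier G \<Longrightarrow> x \<in> carrier G \<Longrightarrow> y \<in> carrier G \<Longrightarrow> conj_by c x = conj_by c y \<longleftrightarrow> x = y"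
  by (simp add: conj_by_def)

lemma (in group) conj_centraliser:
  "c \<in> carrier G \<Longrightarrow> f \<in> carrier G \<Longrightarrow> h \<in> carrier G \<Longrightarrow>
    conj_by c h \<in> centraliser G {conj_by c f} \<longleftrightarrow> h \<in> centraliser G {f}"
  by (simp add: centraliser_iff conj_mult[symmetric] conj_inj)

lemma (in group) ladder_conj:
  assumes "ladder (\<lambda>f h. h \<in> centraliser G {f}) L" "c \<in> carrier G"
    and "\<forall>p\<in>set L. fst p \<in> carrier G \<and> snd p \<in> carrier G"
  shows "ladder (\<lambda>f h. h \<in> centraliser G {f}) (map (\<lambda>p. (conj_by c (fst p), conj_by c (snd p))) L)"
  using assms(1) by (rule ladder_map) (use assms in \<open>simp add: conj_centraliser\<close>)

text \<open>Modulo \<open>N\<close>, powers of the \<open>h\<^sub>i\<close> are powers of \<open>g\<close>. If \<open>x\<close> is the last entry that is not in \<open>N\<close> up to a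
  power, then earlier entries can be corrected by powers of \<open>x\<close> to lie in \<open>N\<close>: since \<open>x\<close> commutes with
  all earlier \<open>f\<close>, this does not affect the ladder. Only \<open>x\<close> itself has to be dropped.\<close>

lemma (in group) ladder_drop_one:
  fixes n :: nat
  assumes root: "\<And>m x k::nat. m \<in> carrier G \<Longrightarrow> x \<in> carrier G \<Longrightarrow> k > 0 \<Longrightarrow>
      m [^] k \<in> centraliser G {x} \<Longrightarrow> m \<in> centraliser G {x}"
    and N: "subgroup N G" and g: "g \<in> carrier G" and n: "n > 0"
    and L: "ladder (\<lambda>f h. h \<in> centraliser G {f}) L"
    and carr: "\<forall>p\<in>set L. fst p \<in> carrier G \<and> snd p \<in> centraliser G {g}"
    and mod: "\<forall>p\<in>set L. \<exists>b::int. snd p [^] n \<otimes> g [^] b \<in> N"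
  shows "\<exists>L'. ladder (\<lambda>f h. h \<in> centraliser G {f}) L' \<and> length L \<le> Suc (length L') \<and>
    (\<forall>p\<in>set L'. fst p \<in> carrier G \<and> snd p \<in> N)"
proof -
  have in_car: "fst p \<in> carrier G" "snd p \<in> carrier G" "snd p \<otimes> g = g \<otimes> snd p" if "p \<in> set L" for p
    using that carr g by (auto simp: centraliser_iff)
  have root_iff: "m [^] k \<in> centraliser G {x} \<longleftrightarrow> m \<in> centraliser G {x}"
    if "m \<in> carrier G" "x \<in> carrier G" "k > 0" for m x and k :: nat
  proof
    have sg: "subgroup (centraliser G {x}) G" using that by (intro subgroup_centraliser) auto
    show "m \<in> centraliser G {x} \<Longrightarrow> m [^] k \<in> centraliser G {x}" by (rule subgroup_nat_pow[OF sg])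
  qed (use root that in blast)
  \<comment> \<open>The correcting exponents below are integers, so root extraction is extended to
    negative exponents through inverses.\<close>
  have root_int: "m \<in> centraliser G {x}"
    if "m \<in> carrier G" "x \<in> carrier G" "k \<noteq> 0" "m [^] k \<in> centraliser G {x}" for m x and k :: int
  proof -
    have sg: "subgroup (centraliser G {x}) G" using that by (intro subgroup_centraliser) auto
    have "m [^] nat \<bar>k\<bar> \<in> centraliser G {x}"
    proof (cases "k < 0")
      case True
      then have "m [^] k = inv (m [^] nat \<bar>k\<bar>)" unfolding int_pow_def2 by simp
      then have "inv (m [^] k) = m [^] nat \<bar>k\<bar>" using that(1) by simp
      then show ?thesis using subgroup.m_inv_closed[OF sg that(4)] by metis
    next
      case False
      then have "m [^] k = m [^] nat \<bar>k\<bar>" unfolding int_pow_def2 by simp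
      then show ?thesis using that(4) by metis
    qed
    then show ?thesis using root[of m x "nat \<bar>k\<bar>"] that by simp
  qed
  \<comment> \<open>By \<open>root_iff\<close>, passing to \<open>n\<close>-th powers of the second
    components does not change which centralisers contain them.\<close>
  define pw where "pw = (\<lambda>p::'a \<times> 'a. (fst p, snd p [^] n))"
  have pw: "ladder (\<lambda>f h. h \<in> centraliser G {f}) (map pw M)"
    if "ladder (\<lambda>f h. h \<in> centraliser G {f}) M" "set M \<subseteq> set L" for M
    using that(1)
  proof (rule ladder_map)
    fix p q assume "p \<in> set M" "q \<in> set M"
    then have "p \<in> set L" "q \<in> set L" using that(2) by auto
    then show "snd q \<in> centraliser G {fst p} \<longleftrightarrow> snd (pw q) \<in> centraliser G {fst (pw p)}"
      using root_iff[of "snd q" "fst p" n] in_car(1)[of p] in_car(2)[of q] n unfolding pw_def by simp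
  qed
  show ?thesis
  proof (cases "\<exists>p\<in>set L. snd p [^] n \<notin> N")
    case False
    have "ladder (\<lambda>f h. h \<in> centraliser G {f}) (map pw L)" using pw[OF L] by simp
    moreover have "length L \<le> Suc (length (map pw L))" by simp
    moreover have "\<forall>p\<in>set (map pw L). fst p \<in> carrier G \<and> snd p \<in> N"
      using False in_car by (auto simp: pw_def)
    ultimately show ?thesis by blast
  next
    case True
    \<comment> \<open>For the entries \<open>zs\<close> after the last bad entry,
      \<open>n\<close>-th powers suffice. For the entries \<open>ys\<close> before it, the ladder
      says that \<open>snd x\<close> commutes with their first components, so multiplying by powers
      of \<open>snd x\<close> is harmless there.\<close>
    from split_list_last_prop[OF True] obtain ys x zs where
      Leq: "L = ys @ x # zs" and x: "snd x [^] n \<notin> N" and zs: "\<forall>p\<in>set zs. snd p [^] n \<in> N" by blast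
    have xL: "x \<in> set L" using Leq by simp
    obtain b :: "'a \<times> 'a \<Rightarrow> int" where b: "\<And>p. p \<in> set L \<Longrightarrow> snd p [^] n \<otimes> g [^] b p \<in> N"
      using mod by metis
    have bx: "b x \<noteq> 0"
    proof
      assume "b x = 0"
      then show False using b[OF xL] x in_car[OF xL] by simp
    qed
    \<comment> \<open>With \<open>snd q [^] n\<close> equal to an element \<open>Z q\<close> of
      \<open>N\<close> times the power of \<open>g\<close> with exponent \<open>- b q\<close>, the
      exponents are chosen so that the two powers of \<open>g\<close> cancel.\<close>
    define c where "c = (\<lambda>p. (snd p [^] n) [^] b x \<otimes> (snd x [^] n) [^] (- b p))"
    have cN: "c p \<in> N" if p: "p \<in> set L" for p
    proof -
      define Z where "Z = (\<lambda>q. snd q [^] n \<otimes> g [^] b q)"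
      have Zc: "Z q \<in> carrier G" if "q \<in> set L" for q using in_car[OF that] g by (simp add: Z_def)
      have gcar: "g \<in> centraliser G {g}" using g by (simp add: centraliser_iff)
      have sg: "subgroup (centraliser G {g}) G" using g by (intro subgroup_centraliser) auto
      have Zg: "Z q \<in> centraliser G {g}" if "q \<in> set L" for q
        unfolding Z_def using that carr
        by (intro subgroup.m_closed[OF sg] subgroup_nat_pow[OF sg] subgroup_int_pow[OF sg] gcar) auto
      have Zcomm: "Z q \<otimes> g [^] i = g [^] i \<otimes> Z q" if "q \<in> set L" for q and i :: int
      proof -
        have "subgroup (centraliser G {Z q}) G" using Zc that by (intro subgroup_centraliser) auto
        moreover have "g \<in> centraliser G {Z q}" using Zg that centraliser_sym Zc g by blast
        ultimately have "g [^] i \<in> centraliser G {Z q}" by (rule subgroup_int_pow)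
        then show ?thesis using Zc that by (simp add: centraliser_iff)
      qed
      have h: "snd q [^] n = Z q \<otimes> g [^] (- b q)" if "q \<in> set L" for q
        using in_car(2)[OF that] g by (simp add: Z_def m_assoc int_pow_neg)
      have pow: "(snd q [^] n) [^] i = Z q [^] i \<otimes> g [^] (- b q * i)" if "q \<in> set L" for q and i :: int
        unfolding h[OF that] int_pow_mult_distrib[OF Zcomm[OF that] Zc[OF that] int_pow_closed[OF g]]
          int_pow_pow[OF g] ..
      have "c p = Z p [^] b x \<otimes> g [^] (- b p * b x) \<otimes> (Z x [^] (- b p) \<otimes> g [^] (- b x * - b p))"
        unfolding c_def pow[OF p] pow[OF xL] ..
      also have "Z x [^] (- b p) \<otimes> g [^] (- b x * - b p) = g [^] (- b x * - b p) \<otimes> Z x [^] (- b p)"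
      proof -
        have sgx: "subgroup (centraliser G {g [^] (- b x * - b p)}) G"
          using g by (intro subgroup_centraliser) auto
        have "Z x \<in> centraliser G {g [^] (- b x * - b p)}"
          using Zcomm[OF xL] Zc[OF xL] g by (simp add: centraliser_iff)
        from subgroup_int_pow[OF sgx this, of "- b p"] show ?thesis using g by (simp add: centraliser_iff)
      qed
      also have "Z p [^] b x \<otimes> g [^] (- b p * b x) \<otimes> (g [^] (- b x * - b p) \<otimes> Z x [^] (- b p))
          = Z p [^] b x \<otimes> (g [^] (- b p * b x) \<otimes> g [^] (- b x * - b p)) \<otimes> Z x [^] (- b p)"
        using Zc[OF p] Zc[OF xL] g by (simp add: m_assoc)
      also have "g [^] (- b p * b x) \<otimes> g [^] (- b x * - b p) = \<one>"
        using g int_pow_mult[of g "- b p * b x" "- b x * - b p"] by (simp add: mult.commute)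
      finally have "c p = Z p [^] b x \<otimes> Z x [^] (- b p)" using Zc[OF p] Zc[OF xL] by simp
      moreover have "Z p \<in> N" "Z x \<in> N" using b p xL by (simp_all add: Z_def)
      ultimately show ?thesis using N subgroup_int_pow subgroup.m_closed by metis
    qed
    \<comment> \<open>Modulo the centraliser of \<open>f\<close>, which contains
      \<open>snd x\<close>, only a power of \<open>snd q\<close> with nonzero exponent is left, and
      roots can be taken.\<close>
    have cR: "c q \<in> centraliser G {f} \<longleftrightarrow> snd q \<in> centraliser G {f}"
      if q: "q \<in> set L" and f: "f \<in> carrier G" and xf: "snd x \<in> centraliser G {f}" for q f
    proof -
      have sg: "subgroup (centraliser G {f}) G" using f by (intro subgroup_centraliser) auto
      have xi: "(snd x [^] n) [^] i \<in> centraliser G {f}" for i :: int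
        using xf sg subgroup_nat_pow subgroup_int_pow by blast
      have hc: "snd q \<in> carrier G" "snd x \<in> carrier G" using in_car q xL by auto
      show ?thesis
      proof
        assume "snd q \<in> centraliser G {f}"
        then show "c q \<in> centraliser G {f}" unfolding c_def
          using xi sg subgroup_nat_pow subgroup_int_pow subgroup.m_closed by metis
      next
        assume "c q \<in> centraliser G {f}"
        then have "c q \<otimes> (snd x [^] n) [^] b q \<in> centraliser G {f}"
          using xi subgroup.m_closed[OF sg] by blast
        also have "c q \<otimes> (snd x [^] n) [^] b q = (snd q [^] n) [^] b x"
          unfolding c_def using hc
          by (simp add: m_assoc int_pow_mult[symmetric] del: int_pow_neg)
        finally have "snd q [^] n \<in> centraliser G {f}" using root_int hc f bx nat_pow_closed by blast
        then show "snd q \<in> centraliser G {f}" using root hc f n by blast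
      qed
    qed
    have Ly: "ladder (\<lambda>f h. h \<in> centraliser G {f}) ys" and Lz: "ladder (\<lambda>f h. h \<in> centraliser G {f}) zs"
      and yx: "\<And>p. p \<in> set ys \<Longrightarrow> snd x \<in> centraliser G {fst p}"
      and yz: "\<And>p q. p \<in> set ys \<Longrightarrow> q \<in> set zs \<Longrightarrow> snd q \<in> centraliser G {fst p}"
      using L by (auto simp: Leq ladder_append)
    define f where "f = (\<lambda>p. (fst p, c p))"
    have "ladder (\<lambda>f h. h \<in> centraliser G {f}) (map f ys)"
      using Ly
    proof (rule ladder_map)
      fix p q assume "p \<in> set ys" "q \<in> set ys"
      then show "snd q \<in> centraliser G {fst p} \<longleftrightarrow> snd (f q) \<in> centraliser G {fst (f p)}"
        using cR[of q "fst p"] in_car[of p] yx[of p] unfolding f_def Leq by simp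
    qed
    moreover have "ladder (\<lambda>f h. h \<in> centraliser G {f}) (map pw zs)"
      using pw[OF Lz] Leq by auto
    moreover have "snd q [^] n \<in> centraliser G {fst p}" if "p \<in> set ys" "q \<in> set zs" for p q
    proof -
      have "subgroup (centraliser G {fst p}) G" using in_car that Leq by (intro subgroup_centraliser) auto
      then show ?thesis using yz[OF that] subgroup_nat_pow by blast
    qed
    ultimately have "ladder (\<lambda>f h. h \<in> centraliser G {f}) (map f ys @ map pw zs)"
      by (auto simp: ladder_append f_def pw_def)
    moreover have "length L \<le> Suc (length (map f ys @ map pw zs))" by (simp add: Leq)
    moreover have "\<forall>p\<in>set (map f ys @ map pw zs). fst p \<in> carrier G \<and> snd p \<in> N"
    proof -
      have "fst (f p) \<in> carrier G \<and> snd (f p) \<in> N" if "p \<in> set ys" for p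
        using that in_car(1)[of p] cN[of p] by (simp add: f_def Leq)
      moreover have "fst (pw p) \<in> carrier G \<and> snd (pw p) \<in> N" if "p \<in> set zs" for p
        using that in_car(1)[of p] zs by (simp add: pw_def Leq)
      ultimately show ?thesis by auto
    qed
    ultimately show ?thesis by blast
  qed
qed

section \<open>Reduced words in partially commutative groups\<close>

locale pc_graph =
  fixes X :: "'a set" and E :: "'a \<Rightarrow> 'a \<Rightarrow> bool"
  assumes E_in: "E x y \<Longrightarrow> x \<in> X \<and> y \<in> X"
    and E_sym: "E x y \<Longrightarrow> E y x"
    and E_irrefl: "\<not> E x x"
begin

section \<open>Words modulo the relations of the group\<close>

abbreviation pe (infix "\<approx>" 50) where "u \<approx> v \<equiv> pc_equiv X E u v"

lemma pe_refl [simp, intro]: "u \<approx> u"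
  by (simp add: pc_equiv_def)

lemma pe_trans [trans]: "u \<approx> v \<Longrightarrow> v \<approx> w \<Longrightarrow> u \<approx> w"
  by (auto simp: pc_equiv_def)

lemma pe_sym: "u \<approx> v \<Longrightarrow> v \<approx> u"
proof -
  have "symp (sup (pc_step X E) (conversep (pc_step X E)))" by (auto simp: symp_def)
  then have "symp ((sup (pc_step X E) (conversep (pc_step X E)))\<^sup>*\<^sup>*)" by (rule symp_rtranclp)
  then show "u \<approx> v \<Longrightarrow> v \<approx> u" by (auto simp: pc_equiv_def symp_def)
qed

lemma pe_step: "pc_step X E u v \<Longrightarrow> u \<approx> v"
  by (auto simp: pc_equiv_def)

lemma pe_context: "u \<approx> v \<Longrightarrow> p @ u @ q \<approx> p @ v @ q"
  unfolding pc_equiv_def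
proof (induction rule: rtranclp_induct)
  case (step v w)
  then show ?case
    by (metis (mono_tags, lifting) conversep.cases conversep.intros pc_step_context rtranclp.rtrancl_into_rtrancl
        sup2CI sup2E)
qed simp

lemma pe_append: "u \<approx> u' \<Longrightarrow> v \<approx> v' \<Longrightarrow> u @ v \<approx> u' @ v'"
  using pe_context[of u u' "[]" v] pe_context[of v v' u' "[]"] pe_trans by fastforce

lemma pe_linv: "fst a \<in> X \<Longrightarrow> [a, linv a] \<approx> []"
  using pe_step[OF pc_step.cancel[of "fst a" X E "[]" "snd a" "[]"]] by (simp add: linv_def)

lemma pe_winv: "supp w \<subseteq> X \<Longrightarrow> w @ winv w \<approx> []"
proof (induction w)
  case (Cons a w)
  have "(a # w) @ winv (a # w) = [a] @ (w @ winv w) @ [linv a]" by simp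
  also have "\<dots> \<approx> [a] @ [] @ [linv a]" using Cons by (intro pe_context) auto
  also have "\<dots> \<approx> []" using Cons.prems pe_linv by simp
  finally show ?case .
qed simp

lemma pe_winv': "supp w \<subseteq> X \<Longrightarrow> winv w @ w \<approx> []"
  using pe_winv[of "winv w"] by simp

lemma pe_winv_cong: "u \<approx> v \<Longrightarrow> winv u \<approx> winv v"
  unfolding pc_equiv_def
proof (induction rule: rtranclp_induct)
  case (step v w)
  have *: "pc_step X E u v \<Longrightarrow> pc_step X E (winv u) (winv v)" for u v
  proof (induction rule: pc_step.induct)
    case (cancel x xs b ys)
    then show ?case using pc_step.cancel[of x X E "winv ys" "b" "winv xs"] by (simp add: linv_def)
  next
    case (comm x y xs b c ys)
    then show ?case using pc_step.comm[of E y x X "winv ys" "\<not> c" "\<not> b" "winv xs"] E_sym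
      by (simp add: linv_def)
  qed
  from step show ?case
    by (metis (mono_tags, lifting) "*" conversep.cases conversep.intros rtranclp.rtrancl_into_rtrancl
        sup2CI sup2E)
qed simp

text \<open>Equality in the partially commutative monoid: two words agree up to swaps of adjacent commuting
  letters iff they have the same projections to all pairs of (possibly equal) non-adjacent generators.
  This makes cancellation immediate.\<close>

definition teq (infix "\<sim>" 50) where
  "u \<sim> v \<longleftrightarrow> (\<forall>x y. \<not> E x y \<longrightarrow> proj x y u = proj x y v)"

lemma teq_refl [simp, intro]: "u \<sim> u" by (simp add: teq_def)
lemma teq_sym: "u \<sim> v \<Longrightarrow> v \<sim> u" by (simp add: teq_def)
lemma teq_trans [trans]: "u \<sim> v \<Longrightarrow> v \<sim> w \<Longrightarrow> u \<sim> w" by (simp add: teq_def)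
lemma teq_append: "u \<sim> u' \<Longrightarrow> v \<sim> v' \<Longrightarrow> u @ v \<sim> u' @ v'" by (simp add: teq_def)
lemma teq_cancel_left [simp]: "p @ u \<sim> p @ v \<longleftrightarrow> u \<sim> v" by (simp add: teq_def)
lemma teq_cancel_right [simp]: "u @ p \<sim> v @ p \<longleftrightarrow> u \<sim> v" by (simp add: teq_def)
lemma teq_cancel_Cons [simp]: "a # u \<sim> a # v \<longleftrightarrow> u \<sim> v"
  using teq_cancel_left[of "[a]"] by simp
lemma teq_winv: "u \<sim> v \<Longrightarrow> winv u \<sim> winv v" by (simp add: teq_def proj_winv)

text \<open>A non-adjacent pair cannot meet both supports: letters from the two supports are
  adjacent, and adjacency is symmetric and irreflexive. So one of the two projections is
  empty.\<close>

lemma teq_commute: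
  assumes "\<And>x y. x \<in> supp u \<Longrightarrow> y \<in> supp v \<Longrightarrow> E x y"
  shows "u @ v \<sim> v @ u"
  unfolding teq_def
proof (intro allI impI)
  fix x y assume *: "\<not> E x y"
  have "proj x y u = [] \<or> proj x y v = []"
  proof (rule ccontr)
    assume "\<not> ?thesis"
    then obtain k l where "k \<in> set (proj x y u)" "l \<in> set (proj x y v)"
      by (metis last_in_set)
    then have "fst k \<in> supp u" "fst l \<in> supp v" "fst k = x \<or> fst k = y" "fst l = x \<or> fst l = y"
      by (auto simp: proj_def supp_def)
    then show False using assms * E_sym E_irrefl by metis
  qed
  then show "proj x y (u @ v) = proj x y (v @ u)" by auto
qed

lemma teq_shift: "(\<And>x. x \<in> supp p \<Longrightarrow> E (fst a) x) \<Longrightarrow> p @ a # q \<sim> a # p @ q"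
  using teq_commute[of "[a]" p] teq_cancel_right[of "[a] @ p" q "p @ [a]"] teq_sym by fastforce

text \<open>The projection to the generator of \<open>a\<close> alone shows that its first
  occurrence in \<open>v\<close> is the letter \<open>a\<close>. An earlier letter not adjacent to
  it would start the projection to the corresponding pair, which has to start with
  \<open>a\<close>.\<close>

lemma teq_Cons_D:
  assumes "a # u \<sim> v"
  shows "\<exists>p q. v = p @ a # q \<and> (\<forall>x\<in>supp p. E (fst a) x) \<and> u \<sim> p @ q"
proof -
  have P: "proj x y (a # u) = proj x y v" if "\<not> E x y" for x y
    using assms that by (auto simp: teq_def)
  have "proj (fst a) (fst a) v \<noteq> []" using P[of "fst a" "fst a"] E_irrefl by auto
  then have "\<exists>l\<in>set v. fst l = fst a" by (auto simp: proj_def filter_empty_conv)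
  from split_list_first_prop[OF this] obtain p b q where
    v: "v = p @ b # q" and b: "fst b = fst a" and p: "\<forall>l\<in>set p. fst l \<noteq> fst a" by blast
  have "proj (fst a) (fst a) p = []" using p by (auto simp: proj_def filter_empty_conv)
  then have "b = a" using P[of "fst a" "fst a"] E_irrefl b v by auto
  have E: "E (fst a) x" if "x \<in> supp p" for x
  proof (rule ccontr)
    assume "\<not> E (fst a) x"
    then have eq: "a # proj (fst a) x u = proj (fst a) x p @ proj (fst a) x (b # q)"
      using P[of "fst a" x] v by simp
    have "proj (fst a) x p \<noteq> []" using that by (auto simp: proj_def supp_def filter_empty_conv)
    then have "a \<in> set (proj (fst a) x p)" using eq by (cases "proj (fst a) x p") auto
    then show False using p by (auto simp: proj_def)
  qed
  have "a # u \<sim> a # p @ q" using assms v \<open>b = a\<close> teq_shift[of p a q] E teq_trans by blast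
  then show ?thesis using v \<open>b = a\<close> E by auto
qed

lemma teq_Nil: "[] \<sim> v \<Longrightarrow> v = []"
proof (cases v)
  case (Cons a w)
  assume "[] \<sim> v"
  then have "proj (fst a) (fst a) [] = proj (fst a) (fst a) v" using E_irrefl unfolding teq_def by blast
  then show ?thesis using Cons by simp
qed

text \<open>The head of \<open>u\<close> is located in \<open>v\<close> by \<open>teq_Cons_D\<close>
  and moved to the front by adjacent swaps, which reduces the claim to the tail.\<close>

lemma teq_imp_pe: "u \<sim> v \<Longrightarrow> u \<approx> v"
proof (induction u arbitrary: v)
  case Nil
  then show ?case using teq_Nil by auto
next
  case (Cons a u)
  from teq_Cons_D[OF Cons.prems] obtain p q where
    v: "v = p @ a # q" and E: "\<And>x. x \<in> supp p \<Longrightarrow> E (fst a) x" and u: "u \<sim> p @ q" by blast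
  have "[a] @ p \<approx> p @ [a]" using E
  proof (induction p)
    case (Cons b p)
    have "[a, b] \<approx> [b, a]"
      using pe_step[OF pc_step.comm[of E "fst a" "fst b" X "[]" "snd a" "snd b" "[]"]] Cons.prems by simp
    from pe_append[OF this, of p p] have "[a] @ b # p \<approx> [b] @ ([a] @ p) @ []" by simp
    also have "\<dots> \<approx> [b] @ (p @ [a]) @ []" using Cons by (intro pe_context) auto
    finally show ?case by simp
  qed simp
  from pe_append[OF this pe_refl[of q]] have 1: "([a] @ p) @ q \<approx> (p @ [a]) @ q" .
  have "a # u \<approx> a # (p @ q)" using pe_append[of "[a]" "[a]"] Cons.IH[OF u] by auto
  then show ?case using 1 v pe_trans by auto
qed

lemma teq_set_length: "u \<sim> v \<Longrightarrow> set u = set v \<and> length u = length v"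
proof (induction u arbitrary: v)
  case Nil
  then show ?case using teq_Nil by auto
next
  case (Cons a u)
  from teq_Cons_D[OF Cons.prems] obtain p q where "v = p @ a # q" "u \<sim> p @ q" by blast
  then show ?case using Cons.IH[of "p @ q"] by auto
qed

lemma teq_supp: "u \<sim> v \<Longrightarrow> supp u = supp v"
  using teq_set_length by (simp add: supp_def)

lemma teq_length: "u \<sim> v \<Longrightarrow> length u = length v"
  using teq_set_length by simp

text \<open>A diamond property: two different possible first letters commute, and removing both
  leaves a common rest. It is the core of \<open>act_comm\<close>.\<close>

lemma teq_Cons_Cons:
  assumes "a # u \<sim> b # v" "a \<noteq> b"
  obtains s where "E (fst a) (fst b)" "u \<sim> b # s" "v \<sim> a # s"
proof -
  from teq_Cons_D[OF assms(1)] obtain p q where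
    v: "b # v = p @ a # q" "\<And>x. x \<in> supp p \<Longrightarrow> E (fst a) x" "u \<sim> p @ q" by blast
  then obtain p' where "p = b # p'" using assms(2) by (cases p) auto
  then show thesis using that[of "p' @ q"] v teq_shift[of p' a q] by auto
qed

text \<open>These are the minimal and maximal letters of the trace of \<open>w\<close>, the ones
  that commutations can bring to the front or to the end.\<close>

definition left where "left a w \<longleftrightarrow> (\<exists>u. w \<sim> a # u)"
definition right where "right a w \<longleftrightarrow> (\<exists>u. w \<sim> u @ [a])"

lemma left_teq: "u \<sim> v \<Longrightarrow> left a u \<longleftrightarrow> left a v"
  unfolding left_def using teq_sym teq_trans by blast

lemma left_iff: "left a w \<longleftrightarrow> (\<exists>p q. w = p @ a # q \<and> (\<forall>x\<in>supp p. E (fst a) x))"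
  unfolding left_def using teq_Cons_D teq_sym teq_shift by metis

lemma right_iff_left: "right a w \<longleftrightarrow> left (linv a) (winv w)"
  unfolding left_def right_def using teq_winv
  by (metis winv_simps linv_linv append_Nil)

lemma left_in_supp: "left a w \<Longrightarrow> fst a \<in> supp w"
  by (auto simp: left_iff)

lemma right_in_supp: "right a w \<Longrightarrow> fst a \<in> supp w"
  by (metis right_iff_left left_in_supp fst_linv supp_simps(4))

lemma left_append:
  assumes "left b (u @ v)"
  shows "left b u \<or> (left b v \<and> (\<forall>x\<in>supp u. E (fst b) x))"
proof -
  from assms obtain p q where w: "u @ v = p @ b # q" and p: "\<forall>x\<in>supp p. E (fst b) x"
    by (auto simp: left_iff)
  from w obtain r where "u = p @ r \<and> r @ v = b # q \<or> u @ r = p \<and> v = r @ b # q"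
    by (auto simp: append_eq_append_conv2)
  then show ?thesis using p
  proof (elim disjE conjE)
    assume "u @ r = p" "v = r @ b # q"
    then show ?thesis using p unfolding left_iff by (metis Un_iff supp_simps(2))
  next
    assume r: "u = p @ r" "r @ v = b # q"
    show ?thesis
    proof (cases r)
      case Nil
      then show ?thesis using p r unfolding left_iff by fastforce
    next
      case (Cons c r')
      then show ?thesis using p r unfolding left_iff by auto
    qed
  qed
qed

lemma left_Cons: "left b (a # w) \<Longrightarrow> b = a \<or> (left b w \<and> E (fst b) (fst a))"
  unfolding left_def using teq_Cons_Cons[of b _ a w] teq_sym E_sym by metis

lemma left_appendI1: "left b u \<Longrightarrow> left b (u @ v)"
  by (fastforce simp: left_iff)

lemma left_appendI2: "left b v \<Longrightarrow> (\<And>x. x \<in> supp u \<Longrightarrow> E (fst b) x) \<Longrightarrow> left b (u @ v)"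
  unfolding left_iff by (metis append.assoc supp_simps(2) Un_iff)

lemma right_append:
  "right b (u @ v) \<Longrightarrow> right b v \<or> (right b u \<and> (\<forall>x\<in>supp v. E (fst b) x))"
  using left_append[of "linv b" "winv v" "winv u"] by (simp add: right_iff_left)

lemma right_appendI1: "right b v \<Longrightarrow> right b (u @ v)"
  using left_appendI1[of "linv b" "winv v" "winv u"] by (simp add: right_iff_left)

lemma right_appendI2: "right b u \<Longrightarrow> (\<And>x. x \<in> supp v \<Longrightarrow> E (fst b) x) \<Longrightarrow> right b (u @ v)"
  using left_appendI2[of "linv b" "winv u" "winv v"] by (simp add: right_iff_left)

text \<open>Stated modulo \<open>\<sim>\<close>, because inverse letters may be separated by letters
  commuting with them.\<close>

definition red where "red w \<longleftrightarrow> \<not> (\<exists>u a v. w \<sim> u @ [a, linv a] @ v)"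

lemma red_teq: "u \<sim> v \<Longrightarrow> red u \<longleftrightarrow> red v"
  unfolding red_def using teq_sym teq_trans by blast

lemma red_Nil [simp]: "red []"
  unfolding red_def using teq_length by fastforce

lemma red_appendD: assumes "red (u @ v)" shows "red u" "red v"
proof -
  show "red u" unfolding red_def
  proof safe
    fix p a q assume "u \<sim> p @ [a, linv a] @ q"
    then have "u @ v \<sim> p @ [a, linv a] @ (q @ v)" using teq_append[of u _ v v] by fastforce
    then show False using assms unfolding red_def by blast
  qed
  show "red v" unfolding red_def
  proof safe
    fix p a q assume "v \<sim> p @ [a, linv a] @ q"
    then have "u @ v \<sim> (u @ p) @ [a, linv a] @ q" by simp
    then show False using assms unfolding red_def by blast
  qed
qed

lemma red_winv: "red (winv w) \<longleftrightarrow> red w"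
proof -
  have "red (winv w)" if "red w" for w
    unfolding red_def
  proof safe
    fix p a q assume "winv w \<sim> p @ [a, linv a] @ q"
    from teq_winv[OF this] have "w \<sim> winv q @ [a, linv a] @ winv p" by simp
    then show False using that unfolding red_def by blast
  qed
  from this[of w] this[of "winv w"] show ?thesis by auto
qed

text \<open>A cancelling pair in a rearrangement of \<open>a # w\<close> either lies in
  \<open>w\<close> or uses the new letter \<open>a\<close>, and then its partner can be moved to the
  front of \<open>w\<close>.\<close>

lemma red_Cons: "red (a # w) \<longleftrightarrow> red w \<and> \<not> left (linv a) w"
proof safe
  show "red w" if "red (a # w)" using red_appendD(2)[of "[a]" w] that by simp
  show False if r: "red (a # w)" and l: "left (linv a) w"
  proof -
    from l obtain u where "w \<sim> linv a # u" by (auto simp: left_def)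
    then have "a # w \<sim> [] @ [a, linv a] @ u" by simp
    then show False using r unfolding red_def by blast
  qed
next
  assume r: "red w" and l: "\<not> left (linv a) w"
  show "red (a # w)" unfolding red_def
  proof safe
    fix u b v assume "a # w \<sim> u @ [b, linv b] @ v"
    from teq_Cons_D[OF this] obtain p q where eq: "u @ [b, linv b] @ v = p @ a # q"
      and p: "\<And>x. x \<in> supp p \<Longrightarrow> E (fst a) x" and w: "w \<sim> p @ q" by blast
    \<comment> \<open>The letter \<open>a\<close> stands before the pair, is its first letter, is
      its second letter, or stands after it. The third case would make a generator adjacent to
      itself.\<close>
    consider r' where "u = p @ a # r'" "q = r' @ [b, linv b] @ v"
      | "u = p" "a = b" "q = linv b # v"
      | "p = u @ [b]" "a = linv b"
      | r' where "p = u @ [b, linv b] @ r'" "v = r' @ a # q"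
    proof -
      from eq consider r where "u = p @ r" "r @ [b, linv b] @ v = a # q"
        | r where "u @ r = p" "[b, linv b] @ v = r @ a # q"
        by (auto simp: append_eq_append_conv2)
      then show thesis
      proof cases
        case 1
        show thesis
        proof (cases r)
          case Nil
          then have "u = p" "a = b" "q = linv b # v" using 1 by auto
          then show thesis by (rule that(2))
        next
          case (Cons c r')
          then show thesis using 1 that(1)[of r'] by auto
        qed
      next
        case (2 r)
        show thesis
        proof (cases r)
          case Nil
          then have "u = p" "a = b" "q = linv b # v" using 2 by auto
          then show thesis by (rule that(2))
        next
          case (Cons c r')
          show thesis
          proof (cases r')
            case Nil
            then have "p = u @ [b]" "a = linv b" using 2 Cons by auto
            then show thesis by (rule that(3))
          next
            case (Cons d s)
            then have "p = u @ [b, linv b] @ s" "v = s @ a # q" using 2 \<open>r = c # r'\<close> by auto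
            then show thesis by (rule that(4))
          qed
        qed
      qed
    qed
    then show False
    proof cases
      case 1
      then have "w \<sim> (p @ r') @ [b, linv b] @ v" using w by simp
      then show ?thesis using r unfolding red_def by blast
    next
      case 2
      then have "w \<sim> linv a # p @ v" using w teq_shift[of p "linv a" v] p teq_trans by auto
      then show ?thesis using l by (auto simp: left_def)
    next
      case 3
      then show ?thesis using p[of "fst b"] E_irrefl by auto
    next
      case 4
      then have "w \<sim> u @ [b, linv b] @ (r' @ q)" using w by simp
      then show ?thesis using r unfolding red_def by blast
    qed
  qed
qed

text \<open>Only the boundary can create a cancellation. When \<open>a\<close> is peeled off the
  first factor, its inverse cannot come to the front from within \<open>u\<close>. If it comes from
  \<open>v\<close>, it passes all of \<open>u\<close>, so \<open>a\<close> passes \<open>u\<close>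
  too and is a last letter of \<open>a # u\<close>.\<close>

lemma red_append_iff:
  "red (u @ v) \<longleftrightarrow> red u \<and> red v \<and> \<not> (\<exists>a. right a u \<and> left (linv a) v)"
proof safe
  show "red u" "red v" if "red (u @ v)" using that by (blast dest: red_appendD)+
  show False if "red (u @ v)" "right a u" "left (linv a) v" for a
  proof -
    from that obtain u' v' where "u \<sim> u' @ [a]" "v \<sim> linv a # v'" by (auto simp: left_def right_def)
    from teq_append[OF this] have "u @ v \<sim> u' @ [a, linv a] @ v'" by simp
    then show False using that unfolding red_def by blast
  qed
next
  assume "red u" "red v" "\<nexists>a. right a u \<and> left (linv a) v"
  then show "red (u @ v)"
  proof (induction u)
    case (Cons a u)
    have "red u" "\<not> left (linv a) u" using Cons.prems red_Cons by auto
    have "red (u @ v)" using Cons \<open>red u\<close> right_appendI1[of _ u "[a]"] by auto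
    moreover have "\<not> left (linv a) (u @ v)"
    proof
      assume "left (linv a) (u @ v)"
      then have l: "left (linv a) v" "\<forall>x\<in>supp u. E (fst a) x"
        using left_append \<open>\<not> left (linv a) u\<close> by fastforce+
      have "right a [a]" unfolding right_def by (metis append_Nil teq_refl)
      then have "right a (a # u)" using right_appendI2[of a "[a]" u] l by simp
      then show False using Cons.prems l by blast
    qed
    ultimately show ?case using red_Cons by simp
  qed simp
qed

text \<open>Reduced words are unique up to \<open>\<sim>\<close> because letters act on reduced words modulo \<open>\<sim>\<close> in a way that
  respects the defining relations of the group.\<close>

definition act where
  "act a w = (if left (linv a) w then (SOME u. w \<sim> linv a # u) else a # w)"

text \<open>Left cancellation makes the choice in \<open>act\<close> harmless modulo
  \<open>\<sim>\<close>.\<close>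

lemma act_left: "w \<sim> linv a # u \<Longrightarrow> act a w \<sim> u"
proof -
  assume *: "w \<sim> linv a # u"
  then have l: "left (linv a) w" by (auto simp: left_def)
  have "w \<sim> linv a # (SOME u. w \<sim> linv a # u)" using someI[of "\<lambda>u. w \<sim> linv a # u", OF *] .
  moreover have "act a w = (SOME u. w \<sim> linv a # u)" using l by (simp add: act_def)
  ultimately have "w \<sim> linv a # act a w" by simp
  from teq_trans[OF teq_sym[OF this] *] show ?thesis by simp
qed

lemma act_not_left: "\<not> left (linv a) w \<Longrightarrow> act a w = a # w"
  by (simp add: act_def)

lemma act_teq: "u \<sim> v \<Longrightarrow> act a u \<sim> act a v"
proof (cases "left (linv a) u")
  case True
  assume uv: "u \<sim> v"
  from True obtain s where s: "u \<sim> linv a # s" by (auto simp: left_def)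
  then have "v \<sim> linv a # s" using uv teq_sym teq_trans by blast
  then show ?thesis using act_left s teq_sym teq_trans by metis
next
  case False
  assume uv: "u \<sim> v"
  then show ?thesis using False left_teq[OF uv] act_not_left by simp
qed

lemma red_act: "red w \<Longrightarrow> red (act a w)"
proof (cases "left (linv a) w")
  case True
  assume "red w"
  from True obtain s where s: "w \<sim> linv a # s" by (auto simp: left_def)
  then show ?thesis using \<open>red w\<close> red_teq red_Cons act_left by metis
qed (simp add: red_Cons act_not_left)

text \<open>If \<open>linv a\<close> removes an \<open>a\<close> from the front of \<open>w\<close>,
  the rest does not start with \<open>linv a\<close>, as \<open>w\<close> is reduced. So acting with
  \<open>a\<close> puts the letter back.\<close>

lemma act_linv: "red w \<Longrightarrow> act a (act (linv a) w) \<sim> w"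
proof (cases "left a w")
  case True
  assume "red w"
  from True obtain s where s: "w \<sim> a # s" by (auto simp: left_def)
  then have r: "red (a # s)" using \<open>red w\<close> red_teq by blast
  have "act (linv a) w \<sim> s" using act_left[of w "linv a" s] s by simp
  then have "act a (act (linv a) w) \<sim> act a s" by (rule act_teq)
  also have "act a s = a # s" using r act_not_left red_Cons by blast
  finally show ?thesis using s teq_sym teq_trans by blast
next
  case False
  then have "act (linv a) w = linv a # w" by (simp add: act_not_left)
  then show ?thesis using act_left by simp
qed

text \<open>If some letter cancels, it may be taken to be \<open>a\<close> by symmetry. If both
  cancel, the diamond gives a common rest. If none cancels, prepending one letter does not let the
  other cancel, and the two prepended letters swap.\<close>

lemma act_comm:
  assumes "E (fst a) (fst b)"
  shows "act a (act b w) \<sim> act b (act a w)"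
proof -
  have *: "act a (act b w) \<sim> act b (act a w)"
    if E: "E (fst a) (fst b)" and l: "left (linv a) w" for a b
  proof -
    from l obtain u where u: "w \<sim> linv a # u" by (auto simp: left_def)
    have ab: "linv a \<noteq> linv b" "linv a \<noteq> b" using E E_irrefl by (metis fst_linv)+
    show ?thesis
    proof (cases "left (linv b) w")
      case True
      then obtain v where v: "w \<sim> linv b # v" by (auto simp: left_def)
      then have "linv a # u \<sim> linv b # v" using u teq_sym teq_trans by blast
      from teq_Cons_Cons[OF this ab(1)] obtain s where s: "u \<sim> linv b # s" "v \<sim> linv a # s" by blast
      have "act a (act b w) \<sim> act a v" using act_left[OF v] act_teq by blast
      also have "\<dots> \<sim> s" using act_left s by blast
      also have "s \<sim> act b u" using act_left s teq_sym by blast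
      also have "\<dots> \<sim> act b (act a w)" using act_left[OF u] act_teq teq_sym by blast
      finally show ?thesis .
    next
      case False
      have nl: "\<not> left (linv b) u"
      proof
        assume "left (linv b) u"
        then have "left (linv b) ([linv a] @ u)" using E E_sym by (intro left_appendI2) auto
        then show False using False u left_teq by auto
      qed
      have "b # w \<sim> b # linv a # u" using u by simp
      also have "\<dots> \<sim> linv a # b # u" using teq_shift[of "[b]" "linv a" u] E by simp
      finally have "act a (act b w) \<sim> b # u" using False act_left act_not_left by simp
      also have "\<dots> = act b u" using nl act_not_left by simp
      also have "\<dots> \<sim> act b (act a w)" using act_left[OF u] act_teq teq_sym by blast
      finally show ?thesis .
    qed
  qed
  show ?thesis
  proof (cases "left (linv a) w \<or> left (linv b) w")
    case True
    then show ?thesis using * assms E_sym teq_sym by blast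
  next
    case False
    have "linv a \<noteq> b" "linv b \<noteq> a" using assms E_irrefl by (metis fst_linv)+
    then have "\<not> left (linv a) (b # w)" "\<not> left (linv b) (a # w)"
      using False left_Cons by blast+
    then have "act a (act b w) = a # b # w" "act b (act a w) = b # a # w"
      using False act_not_left by auto
    then show ?thesis using teq_shift[of "[a]" b w] assms E_sym by simp
  qed
qed

definition nf where "nf w = foldr act w []"

lemma nf_simps [simp]: "nf [] = []" "nf (a # w) = act a (nf w)"
  by (auto simp: nf_def)

lemma red_nf [simp]: "red (nf w)"
  by (induction w) (auto simp: red_act)

lemma nf_append_cong: "nf u \<sim> nf v \<Longrightarrow> nf (p @ u) \<sim> nf (p @ v)"
  by (induction p) (auto intro: act_teq)

text \<open>Invariance under free cancellation is \<open>act_linv\<close>, applicable because normal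
  forms are reduced. Invariance under swaps is \<open>act_comm\<close>.\<close>

lemma nf_step: "pc_step X E u v \<Longrightarrow> nf u \<sim> nf v"
proof (induction rule: pc_step.induct)
  case (cancel x xs b ys)
  show ?case
    by (intro nf_append_cong) (use act_linv[of "nf ys" "(x, b)"] in \<open>simp add: linv_def\<close>)
next
  case (comm x y xs b c ys)
  show ?case
    by (intro nf_append_cong) (use comm act_comm[of "(x,b)" "(y,c)"] in simp)
qed

lemma nf_pe: "u \<approx> v \<Longrightarrow> nf u \<sim> nf v"
  unfolding pc_equiv_def
proof (induction rule: rtranclp_induct)
  case (step v w)
  then show ?case using nf_step teq_sym teq_trans by (metis conversepD sup2E)
qed simp

lemma nf_red: "red w \<Longrightarrow> nf w \<sim> w"
proof (induction w)
  case (Cons a w)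
  then have "red w" "\<not> left (linv a) w" using red_Cons by auto
  then show ?case using Cons.IH act_teq[of "nf w" w a] act_not_left by simp
qed simp

text \<open>The normal form is invariant under \<open>\<approx>\<close>, and a reduced word is its
  own normal form up to \<open>\<sim>\<close>.\<close>

lemma red_unique: "red u \<Longrightarrow> red v \<Longrightarrow> u \<approx> v \<Longrightarrow> u \<sim> v"
  using nf_pe nf_red teq_sym teq_trans by metis

lemma act_pe: "fst a \<in> X \<Longrightarrow> act a w \<approx> a # w"
proof (cases "left (linv a) w")
  case True
  assume X: "fst a \<in> X"
  from True obtain u where u: "w \<sim> linv a # u" by (auto simp: left_def)
  have "a # w \<sim> [a, linv a] @ u" using u by simp
  then have "a # w \<approx> [a, linv a] @ u" by (rule teq_imp_pe)
  also have "\<dots> \<approx> [] @ u" using pe_linv X by (intro pe_append) auto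
  also have "[] @ u \<approx> act a w" using act_left[OF u] teq_imp_pe teq_sym by fastforce
  finally show ?thesis by (rule pe_sym)
qed (simp add: act_not_left)

lemma act_supp: "supp (act a w) \<subseteq> insert (fst a) (supp w)"
  and act_length: "length (act a w) \<le> Suc (length w)"
proof -
  have "supp (act a w) \<subseteq> insert (fst a) (supp w) \<and> length (act a w) \<le> Suc (length w)"
  proof (cases "left (linv a) w")
    case True
    then obtain u where u: "w \<sim> linv a # u" by (auto simp: left_def)
    then show ?thesis
      using act_left[OF u] teq_length teq_supp by fastforce
  qed (auto simp add: act_not_left)
  then show "supp (act a w) \<subseteq> insert (fst a) (supp w)" "length (act a w) \<le> Suc (length w)" by auto
qed

lemma nf_supp: "supp (nf w) \<subseteq> supp w"
  using act_supp by (induction w) fastforce+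

lemma nf_length: "length (nf w) \<le> length w"
  using act_length by (induction w) (auto intro: le_trans)

lemma pe_nf: "supp w \<subseteq> X \<Longrightarrow> nf w \<approx> w"
proof (induction w)
  case (Cons a w)
  have "act a (nf w) \<approx> [a] @ nf w" using act_pe Cons.prems by simp
  also have "\<dots> \<approx> [a] @ w" using Cons by (intro pe_append) auto
  finally show ?case by simp
qed simp

lemma red_length_le: "red u \<Longrightarrow> u \<approx> v \<Longrightarrow> length u \<le> length v"
  by (metis nf_length nf_pe nf_red teq_length)

section \<open>Cyclically reduced words and commutation\<close>

text \<open>A word \<open>g\<close> is cyclically reduced iff \<open>red (g @ g)\<close>.\<close>

lemma red_append_self: "red (h @ g) \<Longrightarrow> red (g @ g) \<Longrightarrow> red ((h @ g) @ g)"
  \<comment> \<open>A last letter of \<open>h @ g\<close> is a last letter of \<open>g\<close>,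
    where \<open>red (g @ g)\<close> excludes cancellation, or is adjacent to all letters of
    \<open>g\<close>, and then its inverse does not occur in \<open>g\<close>.\<close>
  unfolding red_append_iff[of "h @ g" g]
  using right_append red_append_iff[of g g] left_in_supp E_irrefl red_appendD by (metis fst_linv)

lemma red_append_wpow: "red (h @ g) \<Longrightarrow> red (g @ g) \<Longrightarrow> red (h @ wpow g n)"
proof (induction n)
  case 0
  from red_appendD(1)[OF 0(1)] show ?case by simp
next
  case (Suc n)
  have "red ((h @ wpow g n) @ g)" if "red (h @ g)" "red (g @ g)" for n
  proof (induction n)
    case (Suc n)
    from red_append_self[OF this that(2)] show ?case using wpow_snoc[of g n] by simp
  qed (use that in simp)
  then show ?case using Suc wpow_snoc[of g n] by simp
qed

lemma red_wpow_append: "red (g @ h) \<Longrightarrow> red (g @ g) \<Longrightarrow> red (wpow g n @ h)"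
  using red_append_wpow[of "winv h" "winv g" n] red_winv[of "g @ h"] red_winv[of "g @ g"]
    red_winv[of "wpow g n @ h"] by (simp add: winv_wpow)

lemma red_wpow: "red (g @ g) \<Longrightarrow> red (wpow g n)"
  using red_append_wpow red_appendD(2) by blast

lemma nonreduced_shortens:
  assumes "supp u \<subseteq> X" "red u" "red v" "\<not> red (u @ v)"
  shows "length (nf (u @ v)) + 2 \<le> length u + length v"
proof -
  obtain a where "right a u" "left (linv a) v" using assms red_append_iff by blast
  then obtain u' v' where uv: "u \<sim> u' @ [a]" "v \<sim> linv a # v'" by (auto simp: left_def right_def)
  have "fst a \<in> X" using \<open>right a u\<close> right_in_supp assms by blast
  have "u @ v \<sim> u' @ [a, linv a] @ v'" using teq_append[OF uv] by simp
  then have "u @ v \<approx> u' @ [a, linv a] @ v'" by (rule teq_imp_pe)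
  also have "\<dots> \<approx> u' @ [] @ v'" using pe_linv[OF \<open>fst a \<in> X\<close>] by (rule pe_context)
  finally have "nf (u @ v) \<sim> nf (u' @ v')" using nf_pe by simp
  then have "length (nf (u @ v)) \<le> length (u' @ v')"
    using nf_length[of "u' @ v'"] teq_length by simp
  then show ?thesis using teq_length[OF uv(1)] teq_length[OF uv(2)] by simp
qed

text \<open>Each failure of reducedness costs two letters, whereas \<open>h g\<^sup>N\<close> has length at least
  \<open>N \<cdot> |g| - |h|\<close>.\<close>

lemma absorb_right:
  assumes "supp g \<subseteq> X" "supp h \<subseteq> X" "red (g @ g)"
  shows "\<exists>N0. \<forall>N\<ge>N0. red (nf (h @ wpow g N) @ g)"
proof -
  have X: "supp (h @ wpow g N) \<subseteq> X" "supp (nf (h @ wpow g N)) \<subseteq> X" for N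
    using assms supp_wpow[of g N] nf_supp[of "h @ wpow g N"] by auto
  have step: "nf (h @ wpow g N) @ g \<approx> h @ wpow g (Suc N)" for N
    using pe_append[OF pe_nf[OF X(1)] pe_refl, of N g] by (simp only: wpow_snoc append.assoc)
  have red_g: "red g" using assms red_appendD by blast
  have "\<exists>N. red (nf (h @ wpow g N) @ g)"
  proof (rule ccontr)
    assume no: "\<not> ?thesis"
    have upper: "length (nf (h @ wpow g N)) + 2 * N \<le> length h + N * length g" for N
    proof (induction N)
      case 0
      then show ?case using nf_length[of h] by simp
    next
      case (Suc N)
      have "length (nf (nf (h @ wpow g N) @ g)) + 2 \<le> length (nf (h @ wpow g N)) + length g"
        using no X(2) red_g by (intro nonreduced_shortens) auto
      moreover have "nf (nf (h @ wpow g N) @ g) \<sim> nf (h @ wpow g (Suc N))" using step nf_pe by blast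
      ultimately show ?case using Suc teq_length by fastforce
    qed
    \<comment> \<open>The two length bounds together give \<open>2 * N \<le> 2 * length h\<close>,
      so this is the first contradictory value.\<close>
    define N where "N = Suc (length h)"
    have "winv h @ nf (h @ wpow g N) \<approx> winv h @ (h @ wpow g N)"
      by (rule pe_append[OF pe_refl pe_nf[OF X(1)]])
    also have "\<dots> = (winv h @ h) @ wpow g N" by simp
    also have "\<dots> \<approx> [] @ wpow g N" by (rule pe_append[OF pe_winv'[OF assms(2)] pe_refl])
    finally have "wpow g N \<approx> winv h @ nf (h @ wpow g N)" using pe_sym by simp
    from red_length_le[OF red_wpow[OF assms(3)] this]
    have "N * length g \<le> length h + length (nf (h @ wpow g N))" by simp
    then show False using upper[of N] N_def by linarith
  qed
  then obtain N0 where N0: "red (nf (h @ wpow g N0) @ g)" ..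
  \<comment> \<open>Once \<open>g\<close> can be appended without cancellation, all further powers
    can, so appending them to the normal form at \<open>N0\<close> yields the normal form at
    \<open>N\<close>.\<close>
  have "red (nf (h @ wpow g N) @ g)" if "N \<ge> N0" for N
  proof -
    from le_Suc_ex[OF that] obtain k where N: "N = N0 + k" by blast
    have "nf (h @ wpow g N0) @ wpow g k \<approx> (h @ wpow g N0) @ wpow g k"
      by (rule pe_append[OF pe_nf[OF X(1)] pe_refl])
    also have "\<dots> = h @ wpow g N" by (simp add: N wpow_add)
    also have "\<dots> \<approx> nf (h @ wpow g N)" using pe_nf[OF X(1)] pe_sym by blast
    finally have "nf (h @ wpow g N0) @ wpow g k \<sim> nf (h @ wpow g N)"
      using red_append_wpow[OF N0 assms(3)] red_unique red_nf by blast
    from teq_append[OF this teq_refl[of g]]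
    have "nf (h @ wpow g N0) @ wpow g (Suc k) \<sim> nf (h @ wpow g N) @ g"
      by (simp add: wpow_snoc del: wpow_simps)
    then show ?thesis using red_append_wpow[OF N0 assms(3)] red_teq by blast
  qed
  then show ?thesis by blast
qed

lemma pe_wpow_commute: "g @ h \<approx> h @ g \<Longrightarrow> wpow g n @ h \<approx> h @ wpow g n"
proof (induction n)
  case (Suc n)
  have "wpow g (Suc n) @ h = g @ (wpow g n @ h) @ []" by simp
  also have "\<dots> \<approx> g @ (h @ wpow g n) @ []" using Suc by (intro pe_context) auto
  also have "\<dots> = (g @ h) @ wpow g n" by simp
  also have "\<dots> \<approx> (h @ g) @ wpow g n" by (rule pe_append[OF Suc.prems pe_refl])
  finally show ?case by simp
qed simp

text \<open>After absorbing enough powers of \<open>g\<close>, an element of the centraliser of \<open>g\<close> commutes with \<open>g\<close>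
  without any cancellation, so that commutation can be studied in free monoids via projections.\<close>

lemma absorb_powers:
  assumes "supp g \<subseteq> X" "supp h \<subseteq> X" "red (g @ g)" "g @ h \<approx> h @ g"
  obtains N h' where "h' \<approx> h @ wpow g N" "h' @ g \<sim> g @ h'" "supp h' \<subseteq> supp h \<union> supp g"
proof -
  obtain N1 where N1: "\<And>N. N \<ge> N1 \<Longrightarrow> red (nf (h @ wpow g N) @ g)"
    using absorb_right[OF assms(1-3)] by blast
  have "red (winv g @ winv g)" using red_winv[of "g @ g"] assms by simp
  then obtain N2 where N2: "\<And>N. N \<ge> N2 \<Longrightarrow> red (nf (winv h @ wpow (winv g) N) @ winv g)"
    using absorb_right[of "winv g" "winv h"] assms by auto
  define N where "N = max N1 N2"
  define h' where "h' = nf (h @ wpow g N)"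
  have X: "supp (wpow g N) \<subseteq> X" "supp (wpow (winv g) N) \<subseteq> X"
    using assms supp_wpow[of g N] supp_wpow[of "winv g" N] by auto
  \<comment> \<open>Absorption on the left is absorption on the right for the inverses. As
    \<open>g\<close> and \<open>h\<close> commute, \<open>winv k\<close> represents the same element
    as \<open>h'\<close>, so both \<open>g @ h'\<close> and \<open>h' @ g\<close> are
    reduced.\<close>
  define k where "k = nf (winv h @ wpow (winv g) N)"
  have h': "h' \<approx> h @ wpow g N" unfolding h'_def using X assms by (intro pe_nf) auto
  have "k \<approx> winv h @ wpow (winv g) N" unfolding k_def using X assms by (intro pe_nf) auto
  from pe_winv_cong[OF this] have "winv k \<approx> wpow g N @ h" by (simp add: winv_wpow)
  also have "\<dots> \<approx> h @ wpow g N" using assms by (intro pe_wpow_commute)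
  also have "\<dots> \<approx> h'" using h' pe_sym by blast
  finally have "winv k \<sim> h'" using red_unique[of "winv k" h'] red_winv red_nf h'_def k_def by auto
  then have "g @ winv k \<sim> g @ h'" by simp
  moreover have "red (k @ winv g)" using N2[of N] by (simp add: k_def N_def)
  then have "red (g @ winv k)" using red_winv[of "k @ winv g"] by simp
  ultimately have r: "red (g @ h')" using red_teq by blast
  have r': "red (h' @ g)" using N1[of N] by (simp add: h'_def N_def)
  have "h' @ g \<approx> (h @ wpow g N) @ g" by (rule pe_append[OF h' pe_refl])
  also have "\<dots> = h @ wpow g (Suc N)" using wpow_snoc[of g N] by simp
  also have "\<dots> \<approx> wpow g (Suc N) @ h" by (rule pe_sym[OF pe_wpow_commute[OF assms(4)]])
  also have "\<dots> = g @ (wpow g N @ h)" by simp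
  also have "\<dots> \<approx> g @ (h @ wpow g N)" by (rule pe_append[OF pe_refl pe_wpow_commute[OF assms(4)]])
  also have "\<dots> \<approx> g @ h'" by (rule pe_append[OF pe_refl pe_sym[OF h']])
  finally have "h' @ g \<sim> g @ h'" using r r' red_unique by blast
  moreover have "supp h' \<subseteq> supp h \<union> supp g"
    using nf_supp[of "h @ wpow g N"] supp_wpow[of g N] by (auto simp: h'_def)
  ultimately show thesis using that h' by blast
qed

section \<open>Cyclic reduction and uniqueness of roots\<close>

lemma right_single: "right a [b] \<Longrightarrow> a = b"
  using left_Cons[of "linv a" "linv b" "[]"] left_in_supp[of "linv a" "[]"] linv_linv
  by (auto simp: right_iff_left) (metis linv_linv)

text \<open>If \<open>y @ y\<close> is not reduced, a last letter of \<open>y\<close> is inverse to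
  a first letter. Stripping both conjugates \<open>y\<close> to a shorter reduced word.\<close>

lemma cyclic_decomp:
  assumes "red y"
  shows "\<exists>c x. y \<sim> c @ x @ winv c \<and> red (x @ x)"
  using assms
proof (induction "length y" arbitrary: y rule: less_induct)
  case less
  show ?case
  proof (cases "red (y @ y)")
    case True
    then have "y \<sim> [] @ y @ winv [] \<and> red (y @ y)" by simp
    then show ?thesis by blast
  next
    case False
    then obtain a where a: "right a y" "left (linv a) y" using red_append_iff less.prems by blast
    then obtain u where u: "y \<sim> linv a # u" by (auto simp: left_def)
    have "right a ([linv a] @ u)" using a(1) u unfolding right_def
      by (metis append_Cons append_Nil teq_sym teq_trans)
    moreover have "\<not> right a [linv a]" using right_single linv_neq by metis
    ultimately have "right a u" using right_append by blast
    then obtain u' where "u \<sim> u' @ [a]" by (auto simp: right_def)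
    then have "linv a # u \<sim> linv a # u' @ [a]" by simp
    then have y: "y \<sim> [linv a] @ u' @ [a]" using u teq_trans by simp
    then have "red u'" using less.prems red_teq red_appendD by blast
    moreover have "length u' < length y" using teq_length[OF y] by simp
    ultimately obtain c x where c: "u' \<sim> c @ x @ winv c" "red (x @ x)" using less.hyps by blast
    from c(1) have "u' @ [a] \<sim> (c @ x @ winv c) @ [a]" by (simp only: teq_cancel_right)
    then have "[linv a] @ u' @ [a] \<sim> [linv a] @ ((c @ x @ winv c) @ [a])"
      by (simp only: teq_cancel_left)
    then have "y \<sim> (linv a # c) @ x @ winv (linv a # c)" using y teq_trans by fastforce
    then show ?thesis using c(2) by blast
  qed
qed

text \<open>A cancellation with \<open>winv d\<close> would use a last letter of the power, or a
  last letter of \<open>d\<close> adjacent to all of \<open>y\<close>, which would already cancel in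
  \<open>d @ y @ winv d\<close>. The exponent is positive because \<open>d @ winv d\<close> is not
  reduced for nonempty \<open>d\<close>.\<close>

lemma red_conj_wpow:
  assumes "red (d @ y @ winv d)" "red (y @ y)"
  shows "red (d @ wpow y (Suc n) @ winv d)"
proof -
  have "red (d @ y)" "red (y @ winv d)"
    using red_appendD(1)[of "d @ y" "winv d"] red_appendD(2)[of d "y @ winv d"] assms(1) by auto
  then have r: "red (d @ wpow y (Suc n))" "red (wpow y (Suc n) @ winv d)"
    using assms red_append_wpow red_wpow_append by blast+
  have "red ((d @ wpow y (Suc n)) @ winv d)"
  proof (subst red_append_iff, intro conjI notI)
    show "red (d @ wpow y (Suc n))" "red (winv d)" using r red_appendD by blast+
    assume "\<exists>a. right a (d @ wpow y (Suc n)) \<and> left (linv a) (winv d)"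
    then obtain a where a: "right a (d @ wpow y (Suc n))" "left (linv a) (winv d)" by blast
    from right_append[OF a(1)] show False
    proof
      assume "right a (wpow y (Suc n))"
      then show False using r(2) a(2) red_append_iff by blast
    next
      assume *: "right a d \<and> (\<forall>x\<in>supp (wpow y (Suc n)). E (fst a) x)"
      then have "right a (d @ y)" by (intro right_appendI2) auto
      moreover have "red ((d @ y) @ winv d)" using assms(1) by simp
      ultimately show False using a(2) red_append_iff by blast
    qed
  qed
  then show ?thesis by simp
qed

lemma left_wpow: "left a (wpow x n) \<Longrightarrow> left a x"
proof (induction n)
  case 0
  then show ?case using left_in_supp by fastforce
qed (use left_append in fastforce)

lemma right_wpow: "right a (wpow x n) \<Longrightarrow> right a x"
  by (simp add: right_iff_left winv_wpow left_wpow)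

text \<open>Both sides are reduced, hence equal up to \<open>\<sim>\<close>. A first letter of
  \<open>d\<close> would be a first letter of \<open>x\<close> with its inverse a last letter, so
  \<open>d\<close> is empty. Then the projections are equal powers in a free monoid.\<close>

lemma cyclic_root_unique:
  assumes x: "red (x @ x)" and y: "red (y @ y)" "red (d @ y @ winv d)"
    and eq: "wpow x n \<approx> d @ wpow y n @ winv d" and "n > 0"
  shows "x \<approx> d @ y @ winv d"
proof -
  obtain m where n: "n = Suc m" using \<open>n > 0\<close> gr0_implies_Suc by blast
  have t: "wpow x n \<sim> d @ wpow y n @ winv d"
    using eq red_unique red_wpow[OF x] red_conj_wpow[OF y(2,1)] n by blast
  have "d = []"
  proof (rule ccontr)
    assume "d \<noteq> []"
    then obtain a d' where d: "d = a # d'" by (cases d) auto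
    have "left a (wpow x n)" using t d unfolding left_def by (metis append_Cons)
    moreover have "wpow x n \<sim> (d @ wpow y n @ winv d') @ [linv a]" using t d by simp
    then have "right (linv a) (wpow x n)" unfolding right_def by blast
    ultimately show False
      using x left_wpow right_wpow red_append_iff[of x x] linv_linv by metis
  qed
  have "proj v w x = proj v w y" if "\<not> E v w" for v w
  proof -
    have "wpow (proj v w x) n = wpow (proj v w y) n"
      using t \<open>d = []\<close> that by (auto simp: teq_def proj_wpow[symmetric])
    then show ?thesis using wpow_inject \<open>n > 0\<close> by blast
  qed
  then have "x \<sim> y" by (simp add: teq_def)
  then show ?thesis using \<open>d = []\<close> teq_imp_pe by simp
qed

section \<open>Commutation without cancellation\<close>

lemma commute_cnt:
  assumes "h @ g \<sim> g @ h" "\<not> E x y"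
  shows "cnt x h * cnt y g = cnt y h * cnt x g"
proof -
  have "proj x y h @ proj x y g = proj x y g @ proj x y h" using assms by (simp add: teq_def)
  from proj_commute_cnt[OF this, of x y] show ?thesis by simp
qed

text \<open>A letter of \<open>h\<close> other than \<open>p\<close> and not adjacent to
  \<open>p\<close> does not occur in \<open>g\<close>. This contradicts the equal ratios of
  \<open>commute_cnt\<close>, as \<open>p\<close> does occur in \<open>g\<close>.\<close>

lemma commute_clique_supp:
  assumes "h @ g \<sim> g @ h" "p \<in> supp g" "\<And>x. x \<in> supp g \<Longrightarrow> x \<noteq> p \<Longrightarrow> E p x"
    and "y \<in> supp h" "y \<noteq> p"
  shows "E p y"
proof (rule ccontr)
  assume n: "\<not> E p y"
  then have "y \<notin> supp g" using assms by blast
  then have "cnt y g = 0" using cnt_pos_iff[of y g] by simp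
  then have "cnt y h * cnt p g = 0" using commute_cnt[OF assms(1) n] by simp
  then show False using cnt_pos_iff[of y h] cnt_pos_iff[of p g] assms by simp
qed

text \<open>The exponents equalise the numbers of \<open>p\<close> in the two powers, and with them
  the numbers of all letters in \<open>W\<close>, including \<open>q\<close>. On \<open>W\<close>
  the powers then agree, and all remaining letters are adjacent to \<open>p\<close> and
  \<open>q\<close>.\<close>

lemma commute_power_split:
  assumes X: "supp g \<subseteq> X" "supp h \<subseteq> X" and comm: "h @ g \<sim> g @ h"
    and p: "p \<in> supp g" and q: "q \<in> supp g" and npq: "\<not> E p q"
  obtains z where "supp z \<subseteq> supp g \<union> supp h" "\<And>x. x \<in> supp z \<Longrightarrow> E p x \<and> E q x"
    "wpow h (cnt p g) \<approx> z @ wpow g (cnt p h)"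
proof -
  \<comment> \<open>Non-adjacent generators occur in \<open>h\<close> and \<open>g\<close> in the same ratio, so \<open>W\<close> is a union of components of
    the non-commutation graph on the letters involved.\<close>
  define W where "W = {x \<in> supp g. cnt x h * cnt p g = cnt p h * cnt x g}"
  define A where "A = wpow h (cnt p g)"
  define B where "B = wpow g (cnt p h)"
  have W_cnt: "cnt x A = cnt x B" if "x \<in> W" for x using that by (auto simp: W_def A_def B_def mult.commute)
  have pos: "cnt p g > 0" "cnt q g > 0" using p q cnt_pos_iff by fastforce+
  have pW: "p \<in> W" using p by (simp add: W_def)
  have clos: "y \<in> W" if "x \<in> W" "\<not> E x y" "y \<in> supp g \<union> supp h" for x y
  proof -
    have x: "cnt x g > 0" "cnt x h * cnt p g = cnt p h * cnt x g" "cnt x h * cnt y g = cnt y h * cnt x g"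
      using that commute_cnt[OF comm] cnt_pos_iff by (fastforce simp: W_def)+
    have "cnt y g > 0"
    proof (rule ccontr)
      assume "\<not> cnt y g > 0"
      then have "cnt y h = 0" using x by simp
      then show False using \<open>\<not> cnt y g > 0\<close> that(3) cnt_pos_iff by (metis Un_iff less_irrefl)
    qed
    moreover have "(cnt y h * cnt p g) * cnt x g = (cnt p h * cnt y g) * cnt x g"
      by (metis x(2,3) mult.assoc mult.commute)
    then have "cnt y h * cnt p g = cnt p h * cnt y g" using x by simp
    ultimately show ?thesis using cnt_pos_iff[of y g] by (simp add: W_def)
  qed
  have qW: "q \<in> W" using clos[OF pW npq] q by blast
  have suppAB: "supp A \<subseteq> supp h" "supp B \<subseteq> supp g" by (simp_all add: A_def B_def supp_wpow)
  define fW where "fW = filter (\<lambda>l::'a \<times> bool. fst l \<in> W)"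
  define fR where "fR = filter (\<lambda>l::'a \<times> bool. fst l \<notin> W)"
  have supp_f: "supp (fW w) = supp w \<inter> W" "supp (fR w) = supp w - W" for w
    by (auto simp: fW_def fR_def supp_def)
  have EW: "E x y" if "x \<in> W" "y \<in> supp g \<union> supp h - W" for x y using clos that by blast
  have split: "w \<sim> fR w @ fW w" if sw: "supp w \<subseteq> supp g \<union> supp h" for w
    unfolding teq_def
  proof (intro allI impI)
    fix x y assume n: "\<not> E x y"
    have in_supp: "fst l \<in> supp w" if "l \<in> set w" for l using that by (simp add: supp_def)
    consider "x \<in> W" "y \<in> W" | "x \<notin> W" "y \<notin> W" | "x \<in> W" "y \<notin> supp w" "y \<notin> W"
      | "y \<in> W" "x \<notin> supp w" "x \<notin> W"
      using EW[of x y] EW[of y x] n E_sym sw by blast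
    then show "proj x y w = proj x y (fR w @ fW w)"
    proof cases
      case 1
      then have "proj x y (fR w) = []" using supp_f by (intro proj_empty) auto
      moreover have "proj x y (fW w) = proj x y w"
        unfolding proj_def fW_def filter_filter using 1 by (intro filter_cong) auto
      ultimately show ?thesis by simp
    next
      case 2
      then have "proj x y (fW w) = []" using supp_f by (intro proj_empty) auto
      moreover have "proj x y (fR w) = proj x y w"
        unfolding proj_def fR_def filter_filter using 2 by (intro filter_cong) auto
      ultimately show ?thesis by simp
    next
      case 3
      then have "proj x y (fR w) = []" using supp_f by (intro proj_empty) auto
      moreover have "proj x y (fW w) = proj x y w"
        unfolding proj_def fW_def filter_filter using 3 in_supp by (intro filter_cong) auto
      ultimately show ?thesis by simp
    next
      case 4
      then have "proj x y (fR w) = []" using supp_f by (intro proj_empty) auto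
      moreover have "proj x y (fW w) = proj x y w"
        unfolding proj_def fW_def filter_filter using 4 in_supp by (intro filter_cong) auto
      ultimately show ?thesis by simp
    qed
  qed
  \<comment> \<open>Commuting words of equal length coincide.\<close>
  have projW: "proj x y A = proj x y B" if "x \<in> W" "y \<in> W" "\<not> E x y" for x y
  proof -
    have "proj x y h @ proj x y g = proj x y g @ proj x y h" using that comm by (simp add: teq_def)
    from wpow_commute[OF this, of "cnt p g" "cnt p h"]
    have "proj x y A @ proj x y B = proj x y B @ proj x y A" by (simp add: A_def B_def proj_wpow)
    moreover have "length (proj x y A) = length (proj x y B)"
      using W_cnt that length_proj[of x y] by (cases "x = y") (auto simp: cnt_def)
    ultimately show ?thesis using append_eq_append_conv by blast
  qed
  have fW_eq: "fW A \<sim> fW B"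
    unfolding teq_def
  proof (intro allI impI)
    fix x y assume n: "\<not> E x y"
    have pf: "proj x y (fW w) = (if x \<in> W then if y \<in> W then proj x y w else proj x x w
        else if y \<in> W then proj y y w else [])" for w
      unfolding fW_def by (induction w) auto
    show "proj x y (fW A) = proj x y (fW B)"
      unfolding pf using projW n E_irrefl by auto
  qed
  \<comment> \<open>Up to \<open>\<sim>\<close>, \<open>A\<close> and \<open>B\<close> split into
    their parts outside and inside \<open>W\<close>, and the inner parts agree. So \<open>z\<close>
    represents \<open>A\<close> times the inverse of \<open>B\<close>.\<close>
  define z where "z = fR A @ winv (fR B)"
  have RX: "supp (fR B) \<subseteq> X" using supp_f suppAB X by blast
  have "A \<approx> fR A @ fW A" using split suppAB teq_imp_pe by blast
  also have "\<dots> \<approx> fR A @ fW B" by (rule pe_append[OF pe_refl teq_imp_pe[OF fW_eq]])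
  also have "\<dots> \<approx> fR A @ (winv (fR B) @ fR B) @ fW B"
    using pe_context[OF pe_winv'[OF RX], of "fR A" "fW B"] pe_sym by simp
  also have "\<dots> = z @ (fR B @ fW B)" by (simp add: z_def)
  also have "\<dots> \<approx> z @ B" using split[of B] suppAB by (intro pe_append[OF pe_refl] pe_sym[OF teq_imp_pe]) auto
  finally have "A \<approx> z @ B" .
  moreover have "supp z \<subseteq> supp g \<union> supp h - W" using supp_f suppAB by (auto simp: z_def)
  ultimately show thesis using that[of z] EW pW qW unfolding A_def B_def by blast
qed

text \<open>Letters of \<open>T\<close> are stripped from both ends as long as possible. The rest
  \<open>u\<close> is a shortest representative of its double coset modulo the subgroup generated by
  \<open>T\<close>.\<close>

lemma double_coset_decomp:
  assumes "red g"
  shows "\<exists>a u c. g \<sim> a @ u @ c \<and> supp a \<subseteq> T \<and> supp c \<subseteq> T \<and>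
    (\<forall>l. left l u \<longrightarrow> fst l \<notin> T) \<and> (\<forall>l. right l u \<longrightarrow> fst l \<notin> T)"
  using assms
proof (induction "length g" arbitrary: g rule: less_induct)
  case less
  show ?case
  proof (cases "(\<forall>l. left l g \<longrightarrow> fst l \<notin> T) \<and> (\<forall>l. right l g \<longrightarrow> fst l \<notin> T)")
    case True
    then have "g \<sim> [] @ g @ [] \<and> supp [] \<subseteq> T \<and> supp [] \<subseteq> T \<and>
      (\<forall>l. left l g \<longrightarrow> fst l \<notin> T) \<and> (\<forall>l. right l g \<longrightarrow> fst l \<notin> T)" by simp
    then show ?thesis by blast
  next
    case False
    then consider l where "left l g" "fst l \<in> T" | l where "right l g" "fst l \<in> T" by blast
    then show ?thesis
    proof cases
      case 1
      then obtain s where s: "g \<sim> [l] @ s" by (auto simp: left_def)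
      have "red s" using less.prems red_teq[OF s] red_appendD(2)[of "[l]" s] by simp
      moreover have "length s < length g" using teq_length[OF s] by simp
      ultimately obtain a u c where IH: "s \<sim> a @ u @ c" "supp a \<subseteq> T" "supp c \<subseteq> T"
        "\<forall>l. left l u \<longrightarrow> fst l \<notin> T" "\<forall>l. right l u \<longrightarrow> fst l \<notin> T" using less.hyps by blast
      then have "[l] @ s \<sim> (l # a) @ u @ c" by simp
      then have "g \<sim> (l # a) @ u @ c" using s teq_trans by blast
      moreover have "supp (l # a) \<subseteq> T" using IH 1 by simp
      ultimately show ?thesis using IH by blast
    next
      case 2
      then obtain s where s: "g \<sim> s @ [l]" by (auto simp: right_def)
      have "red s" using less.prems red_teq[OF s] red_appendD(1)[of s "[l]"] by simp
      moreover have "length s < length g" using teq_length[OF s] by simp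
      ultimately obtain a u c where IH: "s \<sim> a @ u @ c" "supp a \<subseteq> T" "supp c \<subseteq> T"
        "\<forall>l. left l u \<longrightarrow> fst l \<notin> T" "\<forall>l. right l u \<longrightarrow> fst l \<notin> T" using less.hyps by blast
      then have "s @ [l] \<sim> (a @ u @ c) @ [l]" by (simp only: teq_cancel_right)
      then have "g \<sim> a @ u @ (c @ [l])" using s teq_trans by fastforce
      moreover have "supp (c @ [l]) \<subseteq> T" using IH 2 by simp
      ultimately show ?thesis using IH by blast
    qed
  qed
qed

text \<open>As no end letter of \<open>u\<close> lies in \<open>T\<close>, both \<open>h @ u\<close>
  and \<open>u @ h'\<close> are reduced, so they are equal up to \<open>\<sim>\<close> and can be
  compared by projections.\<close>

lemma double_coset_commute:
  assumes h: "red h" "supp h \<subseteq> T" and h': "red h'" "supp h' \<subseteq> T" and u: "red u"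
    and left: "\<And>l. left l u \<Longrightarrow> fst l \<notin> T" and right: "\<And>l. right l u \<Longrightarrow> fst l \<notin> T"
    and eq: "h @ u \<approx> u @ h'"
    and "x \<in> supp h" "y \<in> supp u"
  shows "E x y"
proof (rule ccontr)
  assume "\<not> E x y"
  have "red (h @ u)" using h u left right_in_supp red_append_iff by (metis fst_linv subsetD)
  moreover have "red (u @ h')" using h' u right left_in_supp red_append_iff by (metis fst_linv subsetD)
  ultimately have t: "h @ u \<sim> u @ h'" using eq red_unique by blast
  obtain l where "l \<in> set u" "fst l = y" using assms by (auto simp: supp_def)
  \<comment> \<open>Let \<open>b\<close> be the first letter of \<open>u\<close> not adjacent to
    some letter \<open>x\<close> of \<open>h\<close>. In the projection to \<open>x\<close> and the
    generator of \<open>b\<close>, the word \<open>u @ h'\<close> starts with \<open>b\<close>, so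
    \<open>b\<close> occurs in \<open>h\<close>. Hence \<open>b\<close> lies over \<open>T\<close>
    and is adjacent to everything before it, which makes it a forbidden first letter of
    \<open>u\<close>.\<close>
  then have "\<exists>l\<in>set u. \<exists>x\<in>supp h. \<not> E x (fst l)" using assms \<open>\<not> E x y\<close> by blast
  from split_list_first_prop[OF this] obtain p b q where
    u_eq: "u = p @ b # q" and "\<exists>x\<in>supp h. \<not> E x (fst b)"
    and "\<forall>l\<in>set p. \<not> (\<exists>x\<in>supp h. \<not> E x (fst l))" by blast
  then obtain x where x: "x \<in> supp h" "\<not> E x (fst b)"
    and pE: "\<And>v z. v \<in> supp h \<Longrightarrow> z \<in> supp p \<Longrightarrow> E v z" by (auto simp: supp_def)
  have "proj x (fst b) p = []" using pE x E_irrefl by (intro proj_empty) blast+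
  then have "proj x (fst b) u = b # proj x (fst b) q" by (simp add: u_eq)
  moreover have "proj x (fst b) h @ proj x (fst b) u = proj x (fst b) u @ proj x (fst b) h'"
    using t x(2) by (simp add: teq_def)
  moreover have "proj x (fst b) h \<noteq> []" using x(1) by (auto simp: proj_def supp_def filter_empty_conv)
  ultimately have "b \<in> set (proj x (fst b) h)" by (cases "proj x (fst b) h") auto
  then have "fst b \<in> supp h" by (auto simp: proj_def supp_def)
  then have "left b u" "fst b \<in> T" using pE h(2) by (auto simp: left_iff u_eq)
  then show False using left by blast
qed

section \<open>The group and its parabolic subgroups\<close>

abbreviation "G \<equiv> pc_group X E"
abbreviation "cl \<equiv> pc_class X E"
abbreviation "gen \<equiv> pc_gen X E"

lemma cl_eq_iff: "cl u = cl v \<longleftrightarrow> u \<approx> v"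
  unfolding pc_class_def using pe_refl pe_sym pe_trans by blast

lemma cl_mult: "cl u \<otimes>\<^bsub>G\<^esub> cl v = cl (u @ v)"
proof -
  have "(\<exists>a b. u \<approx> a \<and> v \<approx> b \<and> a @ b \<approx> w) \<longleftrightarrow> u @ v \<approx> w" for w
    using pe_append[of u _ v _] pe_trans pe_refl by meson
  then show ?thesis by (auto simp: pc_class_def pc_group_def)
qed

lemma cl_one: "\<one>\<^bsub>G\<^esub> = cl []"
  by (simp add: pc_group_def)

lemma pc_words_iff: "w \<in> pc_words X \<longleftrightarrow> supp w \<subseteq> X"
  by (force simp: pc_words_def supp_def)

lemma carrier_iff: "g \<in> carrier G \<longleftrightarrow> (\<exists>w. supp w \<subseteq> X \<and> g = cl w)"
  by (simp add: pc_group_def pc_words_iff image_iff Bex_def)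

lemma cl_closed [simp]: "supp w \<subseteq> X \<Longrightarrow> cl w \<in> carrier G"
  using carrier_iff by blast

lemma group_pc: "group G"
proof (rule groupI)
  fix x y z assume "x \<in> carrier G" "y \<in> carrier G" "z \<in> carrier G"
  then show "x \<otimes>\<^bsub>G\<^esub> y \<otimes>\<^bsub>G\<^esub> z = x \<otimes>\<^bsub>G\<^esub> (y \<otimes>\<^bsub>G\<^esub> z)"
    by (auto simp: carrier_iff cl_mult)
next
  fix x assume "x \<in> carrier G"
  then obtain w where w: "supp w \<subseteq> X" "x = cl w" by (auto simp: carrier_iff)
  have "cl (winv w) \<in> carrier G" using w by simp
  moreover have "cl (winv w) \<otimes>\<^bsub>G\<^esub> x = \<one>\<^bsub>G\<^esub>" using w pe_winv' by (simp add: cl_mult cl_one cl_eq_iff)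
  ultimately show "\<exists>y\<in>carrier G. y \<otimes>\<^bsub>G\<^esub> x = \<one>\<^bsub>G\<^esub>" by blast
next
  show "\<one>\<^bsub>G\<^esub> \<in> carrier G" by (simp add: cl_one)
  fix x y assume "x \<in> carrier G" "y \<in> carrier G"
  then obtain u v where "supp u \<subseteq> X" "x = cl u" "supp v \<subseteq> X" "y = cl v" by (auto simp: carrier_iff)
  then show "x \<otimes>\<^bsub>G\<^esub> y \<in> carrier G" by (simp add: cl_mult)
next
  fix x assume "x \<in> carrier G"
  then show "\<one>\<^bsub>G\<^esub> \<otimes>\<^bsub>G\<^esub> x = x" by (auto simp: carrier_iff cl_mult cl_one)
qed

sublocale G: group G by (rule group_pc)

lemma cl_inv: "supp w \<subseteq> X \<Longrightarrow> inv\<^bsub>G\<^esub> (cl w) = cl (winv w)"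
  using pe_winv' by (intro G.inv_equality) (simp_all add: cl_mult cl_one cl_eq_iff)

lemma cl_pow: "cl w [^]\<^bsub>G\<^esub> (n::nat) = cl (wpow w n)"
  by (induction n) (simp_all add: cl_one cl_mult wpow_snoc del: wpow_simps(2))

lemma cl_conj: "supp c \<subseteq> X \<Longrightarrow> G.conj_by (cl c) (cl w) = cl (winv c @ w @ c)"
  by (simp add: G.conj_by_def cl_inv cl_mult)

text \<open>For cyclically reduced words, equal powers have equal projections, and roots are unique in free
  monoids.\<close>

lemma root_unique:
  assumes "a \<in> carrier G" "b \<in> carrier G" "a [^]\<^bsub>G\<^esub> n = b [^]\<^bsub>G\<^esub> n" "n > (0::nat)"
  shows "a = b"
proof -
  obtain w where w: "supp w \<subseteq> X" "a = cl w" using assms carrier_iff by blast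
  then obtain c x where x: "nf w \<sim> c @ x @ winv c" "red (x @ x)" using cyclic_decomp red_nf by blast
  have cX: "supp c \<subseteq> X" "supp x \<subseteq> X" using teq_supp[OF x(1)] nf_supp[of w] w(1) by auto
  have "a = cl (c @ x @ winv c)" using w x(1) pe_nf[OF w(1)] teq_imp_pe pe_sym pe_trans cl_eq_iff by metis
  \<comment> \<open>Conjugating both elements by \<open>cl c\<close> makes the first one cyclically
    reduced, so only the second one still carries a conjugator \<open>d\<close>.\<close>
  then have a: "G.conj_by (cl c) a = cl x"
    using cX by (simp add: G.conj_by_def cl_inv cl_mult[symmetric] G.m_assoc)
       (simp add: cl_inv[symmetric] G.m_assoc[symmetric])
  have "G.conj_by (cl c) b \<in> carrier G" using cX assms by simp
  then obtain v where v: "supp v \<subseteq> X" "G.conj_by (cl c) b = cl v" using carrier_iff by blast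
  then obtain d y where y: "nf v \<sim> d @ y @ winv d" "red (y @ y)" using cyclic_decomp red_nf by blast
  have dX: "supp d \<subseteq> X" "supp y \<subseteq> X" using teq_supp[OF y(1)] nf_supp[of v] v(1) by auto
  have red: "red (d @ y @ winv d)" using y(1) red_teq red_nf by blast
  have b: "G.conj_by (cl c) b = cl (d @ y @ winv d)"
    using v y(1) pe_nf[OF v(1)] teq_imp_pe pe_sym pe_trans cl_eq_iff by metis
  have conj_form: "cl (d @ u @ winv d) = G.conj_by (cl (winv d)) (cl u)" for u
    using dX cl_conj[of "winv d" u] by simp
  have "cl (wpow x n) = G.conj_by (cl c) (a [^]\<^bsub>G\<^esub> n)"
    using a cX assms(1) by (simp add: G.conj_pow cl_pow)
  also have "\<dots> = G.conj_by (cl c) b [^]\<^bsub>G\<^esub> n" using assms cX by (simp add: G.conj_pow)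
  also have "\<dots> = cl (d @ wpow y n @ winv d)"
    unfolding b conj_form using dX by (simp add: G.conj_pow[symmetric] cl_pow)
  finally have "wpow x n \<approx> d @ wpow y n @ winv d" by (simp add: cl_eq_iff)
  from cyclic_root_unique[OF x(2) y(2) red this assms(4)]
  have "G.conj_by (cl c) a = G.conj_by (cl c) b" using a b cl_eq_iff by simp
  then show ?thesis using G.conj_inj cX assms by simp
qed

text \<open>The conjugate of \<open>m\<close> by \<open>x\<close> has the same \<open>k\<close>-th
  power as \<open>m\<close>, so it equals \<open>m\<close> by uniqueness of roots.\<close>

lemma root_centraliser:
  assumes "m \<in> carrier G" "x \<in> carrier G" "k > (0::nat)" "m [^]\<^bsub>G\<^esub> k \<in> centraliser G {x}"
  shows "m \<in> centraliser G {x}"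
proof -
  have fix_iff: "y \<in> centraliser G {x} \<longleftrightarrow> G.conj_by x y = y" if "y \<in> carrier G" for y
    using assms that G.inv_solve_left'[of y x "y \<otimes>\<^bsub>G\<^esub> x"]
    by (auto simp: G.centraliser_iff G.conj_by_def G.m_assoc)
  have "G.conj_by x m [^]\<^bsub>G\<^esub> k = m [^]\<^bsub>G\<^esub> k"
    using assms fix_iff[of "m [^]\<^bsub>G\<^esub> k"] by (simp add: G.conj_pow)
  from root_unique[OF _ assms(1) this assms(3)] have "G.conj_by x m = m" using assms(1,2) by simp
  then show ?thesis using fix_iff assms by blast
qed

section \<open>Parabolic subgroups and commutation of generators\<close>

definition parabolic :: "'a set \<Rightarrow> ('a \<times> bool) list set set" where
  "parabolic T = cl ` {w. supp w \<subseteq> T}"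

lemma parabolic_carrier: "parabolic X = carrier G"
  by (simp add: parabolic_def set_eq_iff carrier_iff image_iff Bex_def)

lemma parabolic_subset: "T \<subseteq> X \<Longrightarrow> parabolic T \<subseteq> carrier G"
  by (auto simp: parabolic_def)

lemma parabolic_mono: "S \<subseteq> T \<Longrightarrow> parabolic S \<subseteq> parabolic T"
  by (auto simp: parabolic_def)

lemma cl_parabolic: "supp w \<subseteq> T \<Longrightarrow> cl w \<in> parabolic T"
  by (auto simp: parabolic_def)

lemma subgroup_parabolic:
  assumes "T \<subseteq> X"
  shows "subgroup (parabolic T) G"
proof (rule G.subgroupI)
  show "parabolic T \<subseteq> carrier G" using assms by (rule parabolic_subset)
  show "parabolic T \<noteq> {}" using cl_parabolic[of "[]" T] by auto
  fix a assume "a \<in> parabolic T"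
  then obtain u where u: "supp u \<subseteq> T" "a = cl u" by (auto simp: parabolic_def)
  then show "inv\<^bsub>G\<^esub> a \<in> parabolic T" using assms cl_inv[of u] by (simp add: cl_parabolic)
  fix b assume "b \<in> parabolic T"
  then obtain v where "supp v \<subseteq> T" "b = cl v" by (auto simp: parabolic_def)
  then show "a \<otimes>\<^bsub>G\<^esub> b \<in> parabolic T" using u by (simp add: cl_mult cl_parabolic)
qed

lemma parabolic_conj:
  assumes "T \<subseteq> X" "c \<in> parabolic T" "x \<in> parabolic T"
  shows "G.conj_by c x \<in> parabolic T"
  unfolding G.conj_by_def using assms subgroup_parabolic
  by (meson subgroup.m_closed subgroup.m_inv_closed)

lemma parabolic_reduced:
  assumes "T \<subseteq> X" "g \<in> parabolic T"
  obtains w where "red w" "supp w \<subseteq> T" "g = cl w"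
proof -
  obtain u where "supp u \<subseteq> T" "g = cl u" using assms by (auto simp: parabolic_def)
  then have "supp (nf u) \<subseteq> T" "g = cl (nf u)"
    using assms nf_supp[of u] pe_nf[of u] cl_eq_iff pe_sym by auto
  then show thesis using that red_nf by blast
qed

lemma cl_in_subgroup:
  assumes "subgroup H G" "supp w \<subseteq> X" "\<And>y. y \<in> supp w \<Longrightarrow> gen y \<in> H"
  shows "cl w \<in> H"
  using assms(2,3)
proof (induction w)
  case Nil
  then show ?case using subgroup.one_closed[OF assms(1)] by (simp add: cl_one)
next
  case (Cons a w)
  obtain y b where a: "a = (y, b)" by (cases a)
  have y: "cl [(y, True)] \<in> H" using Cons.prems(2)[of y] a by (simp add: pc_gen_def)
  have "cl [a] \<in> H"
  proof (cases b)
    case False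
    have "inv\<^bsub>G\<^esub> (cl [(y, True)]) = cl [a]" using Cons.prems a False by (simp add: cl_inv linv_def)
    then show ?thesis using subgroup.m_inv_closed[OF assms(1) y] by simp
  qed (use y a in simp)
  then show ?case using Cons subgroup.m_closed[OF assms(1), of "cl [a]" "cl w"] by (simp add: cl_mult)
qed

lemma gen_closed: "x \<in> X \<Longrightarrow> gen x \<in> carrier G"
  by (simp add: pc_gen_def)

text \<open>For distinct non-adjacent generators both products are reduced words, and their
  projections to this pair start with different letters.\<close>

lemma gen_commute_iff:
  assumes "x \<in> X" "y \<in> X"
  shows "gen y \<in> centraliser G {gen x} \<longleftrightarrow> x = y \<or> E x y"
proof -
  have iff: "gen y \<in> centraliser G {gen x} \<longleftrightarrow> [(y, True), (x, True)] \<approx> [(x, True), (y, True)]"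
    using assms gen_closed by (simp add: G.centraliser_iff) (simp add: pc_gen_def cl_mult cl_eq_iff)
  show ?thesis
  proof (cases "x = y \<or> E x y")
    case True
    then have "[(y, True), (x, True)] \<approx> [(x, True), (y, True)]"
      using teq_shift[of "[(y, True)]" "(x, True)" "[]"] teq_imp_pe by auto
    then show ?thesis using True iff by blast
  next
    case False
    have red: "red [(u, True), (v, True)]" for u v
    proof -
      have "\<not> left (linv (u, True)) [(v, True)]"
        using left_Cons[of "linv (u, True)" "(v, True)" "[]"] left_in_supp[of _ "[]"]
        by (auto simp: linv_def)
      moreover have "\<not> left (linv (v, True)) []" using left_in_supp by fastforce
      ultimately show ?thesis by (simp add: red_Cons)
    qed
    have "\<not> [(y, True), (x, True)] \<approx> [(x, True), (y, True)]"
    proof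
      assume "[(y, True), (x, True)] \<approx> [(x, True), (y, True)]"
      then have "[(y, True), (x, True)] \<sim> [(x, True), (y, True)]" using red red_unique by blast
      then have "proj x y [(y, True), (x, True)] = proj x y [(x, True), (y, True)]"
        using False unfolding teq_def by blast
      then have "hd (proj x y [(y, True), (x, True)]) = hd (proj x y [(x, True), (y, True)])"
        by (rule arg_cong)
      then have "y = x" by simp
      then show False using False by blast
    qed
    then show ?thesis using False iff by blast
  qed
qed

lemma commuting_supports:
  assumes "supp u \<subseteq> X" "supp v \<subseteq> X" "\<And>x y. x \<in> supp u \<Longrightarrow> y \<in> supp v \<Longrightarrow> x = y \<or> E x y"
  shows "cl v \<in> centraliser G {cl u}"
proof (rule cl_in_subgroup[OF G.subgroup_centraliser])
  fix y assume y: "y \<in> supp v"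
  then have yX: "y \<in> X" using assms by blast
  have "cl u \<in> centraliser G {gen y}"
  proof (rule cl_in_subgroup[OF G.subgroup_centraliser])
    fix x assume "x \<in> supp u"
    then show "gen x \<in> centraliser G {gen y}"
      using assms y yX gen_commute_iff[of y x] E_sym by blast
  qed (use yX gen_closed assms in auto)
  then show "gen y \<in> centraliser G {cl u}" using G.centraliser_sym[of "gen y" "cl u"] yX gen_closed assms(1) by simp
qed (use assms in auto)

abbreviation gladder :: "(('a \<times> bool) list set \<times> ('a \<times> bool) list set) list \<Rightarrow> bool" where
  "gladder \<equiv> ladder (\<lambda>f h. h \<in> centraliser G {f})"

abbreviation xladder :: "('a \<times> 'a) list \<Rightarrow> bool" where
  "xladder \<equiv> ladder (\<lambda>x y. x = y \<or> E x y)"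

text \<open>Only the second components are confined to \<open>T\<close>. The first ones range over
  the whole group, so shrinking \<open>T\<close> puts no condition on them.\<close>

definition gladder_in where
  "gladder_in T L \<longleftrightarrow> gladder L \<and> (\<forall>p\<in>set L. fst p \<in> carrier G \<and> snd p \<in> parabolic T)"

definition xladder_in where
  "xladder_in T M \<longleftrightarrow> xladder M \<and> (\<forall>p\<in>set M. fst p \<in> X \<and> snd p \<in> T)"

lemma gladder_in_Cons:
  "gladder_in T (p # L) \<longleftrightarrow> fst p \<in> carrier G \<and> snd p \<in> parabolic T \<and>
     snd p \<notin> centraliser G {fst p} \<and> (\<forall>q\<in>set L. snd q \<in> centraliser G {fst p}) \<and> gladder_in T L"
  by (auto simp: gladder_in_def)

text \<open>All second components of \<open>M\<close> lie in \<open>T'\<close> and hence commute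
  with \<open>x\<close>, so the new pair may stand in front.\<close>

lemma xladder_in_extend:
  assumes "x \<in> X" "y \<in> T" "x \<noteq> y" "\<not> E x y" "xladder_in T' M" "T' \<subseteq> {t \<in> T. x = t \<or> E x t}"
  shows "xladder_in T ((x, y) # M)"
  using assms unfolding xladder_in_def by (auto simp: subset_iff)

lemma gladder_in_conj:
  assumes "gladder_in T L" "T \<subseteq> X" "c \<in> carrier G" "\<forall>p\<in>set L. G.conj_by c (snd p) \<in> parabolic S"
  shows "gladder_in S (map (\<lambda>p. (G.conj_by c (fst p), G.conj_by c (snd p))) L)"
proof -
  have *: "\<forall>p\<in>set L. fst p \<in> carrier G \<and> snd p \<in> carrier G"
    using assms parabolic_subset unfolding gladder_in_def by blast
  then have "gladder (map (\<lambda>p. (G.conj_by c (fst p), G.conj_by c (snd p))) L)"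
    using assms(1,3) unfolding gladder_in_def by (intro G.ladder_conj) auto
  then show ?thesis using * assms(3,4) by (auto simp: gladder_in_def)
qed

text \<open>After powers of \<open>g\<close> are absorbed, \<open>commute_clique_supp\<close>
  confines the letters of \<open>h'\<close> to \<open>p\<close> and its neighbours. The letters of
  \<open>g\<close> are confined in the same way, so the absorbed powers can be removed
  again.\<close>

lemma centraliser_cyclic_clique:
  assumes g: "supp g \<subseteq> X" "red (g @ g)" and h: "h \<in> parabolic T" "h \<in> centraliser G {cl g}"
    and T: "T \<subseteq> X" "supp g \<subseteq> T"
    and p: "p \<in> supp g" and clique: "\<And>x. x \<in> supp g \<Longrightarrow> x \<noteq> p \<Longrightarrow> E p x"
  shows "h \<in> parabolic {t \<in> T. p = t \<or> E p t}"
proof -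
  obtain w where w: "supp w \<subseteq> T" "h = cl w" using h by (auto simp: parabolic_def)
  have wX: "supp w \<subseteq> X" using w T by blast
  have "g @ w \<approx> w @ g"
    using h w g wX by (simp add: G.centraliser_iff cl_mult cl_eq_iff pe_sym)
  from absorb_powers[OF g(1) wX g(2) this] obtain N h' where
    h': "h' \<approx> w @ wpow g N" "h' @ g \<sim> g @ h'" "supp h' \<subseteq> supp w \<union> supp g" .
  have 1: "supp h' \<subseteq> {t \<in> T. p = t \<or> E p t}"
    using commute_clique_supp[OF h'(2) p clique] h'(3) w T by blast
  have 2: "supp (winv (wpow g N)) \<subseteq> {t \<in> T. p = t \<or> E p t}"
    using supp_wpow[of g N] T clique by auto
  have "h = cl (h' @ winv (wpow g N))"
  proof -
    have gX: "supp (wpow g N) \<subseteq> X" using supp_wpow[of g N] g by blast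
    have "cl h' = h \<otimes>\<^bsub>G\<^esub> cl (wpow g N)" using h'(1) w by (simp add: cl_mult cl_eq_iff)
    then have "h = cl h' \<otimes>\<^bsub>G\<^esub> inv\<^bsub>G\<^esub> (cl (wpow g N))"
      using gX wX w by (simp add: G.m_assoc)
    then show ?thesis using gX by (simp add: cl_inv cl_mult)
  qed
  then show ?thesis using 1 2 by (simp add: cl_parabolic)
qed

text \<open>Absorption followed by \<open>commute_power_split\<close>, read in the group. The
  exponent \<open>cnt p g\<close> does not depend on \<open>h\<close>, as
  \<open>ladder_drop_one\<close> requires. The exponent of \<open>g\<close> is the absorbed amount
  minus the one split off.\<close>

lemma centraliser_cyclic_mod:
  assumes g: "supp g \<subseteq> X" "red (g @ g)" and h: "h \<in> parabolic T" "h \<in> centraliser G {cl g}"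
    and T: "T \<subseteq> X" "supp g \<subseteq> T"
    and p: "p \<in> supp g" and q: "q \<in> supp g" and npq: "\<not> E p q"
  shows "\<exists>b::int. h [^]\<^bsub>G\<^esub> cnt p g \<otimes>\<^bsub>G\<^esub> cl g [^]\<^bsub>G\<^esub> b \<in> parabolic {t \<in> T. E p t \<and> E q t}"
proof -
  obtain w where w: "supp w \<subseteq> T" "h = cl w" using h by (auto simp: parabolic_def)
  have wX: "supp w \<subseteq> X" using w T by blast
  have car: "h \<in> carrier G" "cl g \<in> carrier G" and comm: "h \<otimes>\<^bsub>G\<^esub> cl g = cl g \<otimes>\<^bsub>G\<^esub> h"
    using h g by (auto simp: G.centraliser_iff)
  have "g @ w \<approx> w @ g" using comm w by (simp add: cl_mult cl_eq_iff pe_sym)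
  from absorb_powers[OF g(1) wX g(2) this] obtain N h' where
    h': "h' \<approx> w @ wpow g N" "h' @ g \<sim> g @ h'" "supp h' \<subseteq> supp w \<union> supp g" .
  have h'X: "supp h' \<subseteq> X" using h' wX g by blast
  from commute_power_split[OF g(1) h'X h'(2) p q npq] obtain z where
    z: "supp z \<subseteq> supp g \<union> supp h'" "\<And>x. x \<in> supp z \<Longrightarrow> E p x \<and> E q x"
    "wpow h' (cnt p g) \<approx> z @ wpow g (cnt p h')" by blast
  let ?n = "cnt p g" and ?m = "cnt p h'"
  have zX: "supp z \<subseteq> X" using z h'X g by blast
  have "cl h' = h \<otimes>\<^bsub>G\<^esub> cl g [^]\<^bsub>G\<^esub> N" using h'(1) w by (simp add: cl_mult cl_eq_iff cl_pow)
  moreover have "cl h' [^]\<^bsub>G\<^esub> ?n = cl z \<otimes>\<^bsub>G\<^esub> cl g [^]\<^bsub>G\<^esub> ?m"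
    using z(3) by (simp add: cl_mult cl_eq_iff cl_pow)
  moreover have "(h \<otimes>\<^bsub>G\<^esub> cl g [^]\<^bsub>G\<^esub> N) [^]\<^bsub>G\<^esub> ?n = h [^]\<^bsub>G\<^esub> ?n \<otimes>\<^bsub>G\<^esub> cl g [^]\<^bsub>G\<^esub> (N * ?n)"
  proof -
    have "cl g \<in> centraliser G {h}" using car comm by (simp add: G.centraliser_iff)
    then have "cl g [^]\<^bsub>G\<^esub> N \<in> centraliser G {h}"
      using G.subgroup_nat_pow[OF G.subgroup_centraliser] car by blast
    then have "h \<otimes>\<^bsub>G\<^esub> cl g [^]\<^bsub>G\<^esub> N = cl g [^]\<^bsub>G\<^esub> N \<otimes>\<^bsub>G\<^esub> h" using car by (simp add: G.centraliser_iff)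
    from G.pow_mult_distrib[OF this car(1)] show ?thesis using car by (simp add: G.nat_pow_pow)
  qed
  ultimately have eq: "h [^]\<^bsub>G\<^esub> ?n \<otimes>\<^bsub>G\<^esub> cl g [^]\<^bsub>G\<^esub> (N * ?n) = cl z \<otimes>\<^bsub>G\<^esub> cl g [^]\<^bsub>G\<^esub> ?m" by simp
  have "h [^]\<^bsub>G\<^esub> ?n \<otimes>\<^bsub>G\<^esub> cl g [^]\<^bsub>G\<^esub> (int (N * ?n) + - int ?m)
      = h [^]\<^bsub>G\<^esub> ?n \<otimes>\<^bsub>G\<^esub> cl g [^]\<^bsub>G\<^esub> (N * ?n) \<otimes>\<^bsub>G\<^esub> cl g [^]\<^bsub>G\<^esub> (- int ?m)"
    unfolding G.int_pow_mult[OF car(2)] int_pow_int using car by (simp add: G.m_assoc)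
  also have "\<dots> = cl z \<otimes>\<^bsub>G\<^esub> (cl g [^]\<^bsub>G\<^esub> ?m \<otimes>\<^bsub>G\<^esub> inv\<^bsub>G\<^esub> (cl g [^]\<^bsub>G\<^esub> ?m))"
    unfolding eq G.int_pow_neg_int[OF car(2)] using car zX by (simp add: G.m_assoc)
  also have "\<dots> = cl z" using car zX by simp
  finally have "h [^]\<^bsub>G\<^esub> ?n \<otimes>\<^bsub>G\<^esub> cl g [^]\<^bsub>G\<^esub> (int (N * ?n) + - int ?m) = cl z" .
  moreover have "supp z \<subseteq> {t \<in> T. E p t \<and> E q t}" using z(1,2) h'(3) w T by blast
  then have "cl z \<in> parabolic {t \<in> T. E p t \<and> E q t}" by (rule cl_parabolic)
  ultimately show ?thesis by metis
qed

text \<open>With \<open>g = a u c\<close> as in \<open>double_coset_decomp\<close>, conjugation by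
  \<open>a\<close> turns \<open>g\<close> into \<open>u d\<close>, where \<open>d = c a\<close>. For
  \<open>k\<close> in the parabolic subgroup commuting with \<open>g\<close>, its conjugate
  \<open>v\<close> satisfies \<open>v u = u (d v d^-1)\<close>, and
  \<open>double_coset_commute\<close> applies.\<close>

lemma parabolic_centraliser_reduction:
  assumes "T \<subseteq> X" "g \<in> carrier G"
  obtains a u where "a \<in> parabolic T"
    "\<And>k. k \<in> parabolic T \<Longrightarrow> k \<in> centraliser G {g} \<Longrightarrow>
       G.conj_by a k \<in> parabolic {t \<in> T. \<forall>y\<in>supp u. E t y}"
    "supp u \<subseteq> X" "\<And>l. left l u \<Longrightarrow> fst l \<notin> T"
    "\<exists>d\<in>parabolic T. g = a \<otimes>\<^bsub>G\<^esub> cl u \<otimes>\<^bsub>G\<^esub> d \<otimes>\<^bsub>G\<^esub> inv\<^bsub>G\<^esub> a"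
proof -
  obtain w where w: "red w" "supp w \<subseteq> X" "g = cl w"
    using parabolic_reduced[of X g] assms parabolic_carrier by auto
  obtain a u c where d: "w \<sim> a @ u @ c" "supp a \<subseteq> T" "supp c \<subseteq> T"
    "\<forall>l. left l u \<longrightarrow> fst l \<notin> T" "\<forall>l. right l u \<longrightarrow> fst l \<notin> T"
    using double_coset_decomp[OF w(1)] by blast
  have uX: "supp u \<subseteq> X" and aX: "supp a \<subseteq> X" and cX: "supp c \<subseteq> X" using teq_supp[OF d(1)] w by auto
  have red_u: "red u" using d(1) w(1) red_teq red_appendD by blast
  have g: "g = cl a \<otimes>\<^bsub>G\<^esub> cl u \<otimes>\<^bsub>G\<^esub> cl c"
    using d(1) w teq_imp_pe by (simp add: cl_mult cl_eq_iff)
  have conj_g: "G.conj_by (cl a) g = cl u \<otimes>\<^bsub>G\<^esub> cl (c @ a)"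
    using uX aX cX unfolding G.conj_by_def g by (simp add: G.m_assoc cl_mult[symmetric] G.inv_solve_left')
  have main: "G.conj_by (cl a) k \<in> parabolic {t \<in> T. \<forall>y\<in>supp u. E t y}"
    if k: "k \<in> parabolic T" "k \<in> centraliser G {g}" for k
  proof -
    have "G.conj_by (cl a) k \<in> parabolic T" using parabolic_conj assms(1) d(2) k(1) cl_parabolic by blast
    then obtain v where v: "red v" "supp v \<subseteq> T" "G.conj_by (cl a) k = cl v"
      using parabolic_reduced assms(1) by metis
    let ?d = "c @ a"
    have kc: "k \<in> carrier G" using k assms parabolic_subset by blast
    have vX: "supp v \<subseteq> X" using v assms by blast
    have dX: "supp ?d \<subseteq> X" using aX cX by simp
    have "cl v \<in> centraliser G {cl (u @ ?d)}"
      using k(2) kc G.conj_centraliser[of "cl a" g k] aX assms(2) conj_g v by (simp add: cl_mult)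
    then have "cl (v @ u @ ?d) = cl (u @ ?d @ v)" using uX dX by (simp add: G.centraliser_iff cl_mult)
    then have "cl (v @ u) \<otimes>\<^bsub>G\<^esub> cl ?d \<otimes>\<^bsub>G\<^esub> inv\<^bsub>G\<^esub> cl ?d = cl (u @ ?d @ v) \<otimes>\<^bsub>G\<^esub> inv\<^bsub>G\<^esub> cl ?d" by (simp add: cl_mult)
    then have "cl (v @ u) = cl (u @ (?d @ v @ winv ?d))"
      using uX vX dX by (simp add: G.m_assoc) (simp add: cl_inv cl_mult)
    moreover have "cl (?d @ v @ winv ?d) = cl (nf (?d @ v @ winv ?d))"
      using vX dX pe_nf[of "?d @ v @ winv ?d"] pe_sym by (simp add: cl_eq_iff)
    ultimately have "cl (v @ u) = cl (u @ nf (?d @ v @ winv ?d))" by (metis cl_mult)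
    then have eq: "v @ u \<approx> u @ nf (?d @ v @ winv ?d)" by (simp only: cl_eq_iff)
    have "supp (nf (?d @ v @ winv ?d)) \<subseteq> T" using nf_supp[of "?d @ v @ winv ?d"] d v by auto
    then have "E x y" if "x \<in> supp v" "y \<in> supp u" for x y
      using double_coset_commute[OF v(1,2) red_nf _ red_u _ _ eq that] d(4,5) by blast
    then have "supp v \<subseteq> {t \<in> T. \<forall>y\<in>supp u. E t y}" using v(2) by blast
    then show ?thesis using v(3) cl_parabolic by simp
  qed
  have "g = cl a \<otimes>\<^bsub>G\<^esub> cl u \<otimes>\<^bsub>G\<^esub> cl (c @ a) \<otimes>\<^bsub>G\<^esub> inv\<^bsub>G\<^esub> (cl a)"
    unfolding g cl_mult[of c a, symmetric] using aX uX cX by (simp add: G.m_assoc)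
  moreover have "cl (c @ a) \<in> parabolic T" using d by (simp add: cl_parabolic)
  ultimately show thesis using that[of "cl a" u] main uX d(2,4) cl_parabolic by blast
qed

section \<open>From group elements to generators\<close>

lemma ladder_reduction_parabolic:
  assumes T: "T \<subseteq> X"
    and IH: "\<And>T' L'. T' \<subset> T \<Longrightarrow> gladder_in T' L' \<Longrightarrow> \<exists>M. xladder_in T' M \<and> length L' \<le> length M"
    and L: "gladder_in T ((g, h) # L)" and g: "g \<in> parabolic T"
  shows "\<exists>M. xladder_in T M \<and> Suc (length L) \<le> length M"
proof -
  obtain w where w: "red w" "supp w \<subseteq> T" "g = cl w" using parabolic_reduced[OF T g] .
  obtain c x where cx: "w \<sim> c @ x @ winv c" "red (x @ x)" using cyclic_decomp[OF w(1)] by blast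
  have cT: "supp c \<subseteq> T" and xT: "supp x \<subseteq> T" using teq_supp[OF cx(1)] w(2) by auto
  have cX: "supp c \<subseteq> X" and xX: "supp x \<subseteq> X" using cT xT T by auto
  have "g = cl c \<otimes>\<^bsub>G\<^esub> cl x \<otimes>\<^bsub>G\<^esub> inv\<^bsub>G\<^esub> (cl c)"
    using w cx(1) teq_imp_pe cX by (simp add: cl_inv cl_mult cl_eq_iff)
  then have conj_g: "G.conj_by (cl c) g = cl x"
    using cX xX unfolding G.conj_by_def by (simp add: G.m_assoc G.inv_solve_left')
  define F where "F = (\<lambda>p. (G.conj_by (cl c) (fst p), G.conj_by (cl c) (snd p)))"
  have "gladder_in T (map F ((g, h) # L))"
    unfolding F_def
  proof (rule gladder_in_conj[OF L T])
    show "\<forall>p\<in>set ((g, h) # L). G.conj_by (cl c) (snd p) \<in> parabolic T"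
      using L parabolic_conj[OF T cl_parabolic[OF cT]] unfolding gladder_in_def by blast
  qed (use cX in simp)
  then have L': "gladder_in T ((cl x, G.conj_by (cl c) h) # map F L)" by (simp add: F_def conj_g)
  define k where "k = G.conj_by (cl c) h"
  have k: "k \<in> parabolic T" "k \<notin> centraliser G {cl x}" and Lc: "gladder_in T (map F L)"
    and comm: "\<And>q. q \<in> set (map F L) \<Longrightarrow> snd q \<in> centraliser G {cl x}"
    using L' unfolding gladder_in_Cons k_def by auto
  have par: "fst q \<in> carrier G" "snd q \<in> parabolic T" if "q \<in> set (map F L)" for q
    using Lc that unfolding gladder_in_def by auto
  show ?thesis
  proof (cases "\<exists>p\<in>supp x. \<exists>q\<in>supp x. p \<noteq> q \<and> \<not> E p q")
    case True
    then obtain p q where pq: "p \<in> supp x" "q \<in> supp x" "p \<noteq> q" "\<not> E p q" by blast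
    let ?T' = "{t \<in> T. E p t \<and> E q t}"
    have "\<exists>L''. gladder L'' \<and> length (map F L) \<le> Suc (length L'') \<and>
        (\<forall>r\<in>set L''. fst r \<in> carrier G \<and> snd r \<in> parabolic ?T')"
    proof (rule G.ladder_drop_one[where g = "cl x" and n = "cnt p x"])
      show "m \<in> centraliser G {y}"
        if "m \<in> carrier G" "y \<in> carrier G" "0 < k" "m [^]\<^bsub>G\<^esub> k \<in> centraliser G {y}" for m y and k :: nat
        using that by (rule root_centraliser)
      show "subgroup (parabolic ?T') G" using T by (intro subgroup_parabolic) auto
      show "cl x \<in> carrier G" using xX by simp
      show "cnt p x > 0" using pq cnt_pos_iff[of p x] by simp
      show "gladder (map F L)" using Lc by (simp add: gladder_in_def)
      show "\<forall>r\<in>set (map F L). fst r \<in> carrier G \<and> snd r \<in> centraliser G {cl x}"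
        using par comm by blast
      show "\<forall>r\<in>set (map F L). \<exists>b::int.
          snd r [^]\<^bsub>G\<^esub> cnt p x \<otimes>\<^bsub>G\<^esub> cl x [^]\<^bsub>G\<^esub> b \<in> parabolic ?T'"
        using centraliser_cyclic_mod[OF xX cx(2) par(2) comm T xT pq(1,2,4)] by blast
    qed
    then obtain L'' where L'': "gladder_in ?T' L''" "length L \<le> Suc (length L'')"
      unfolding gladder_in_def by auto
    moreover have "?T' \<subset> T" using pq xT E_irrefl by blast
    ultimately obtain M where M: "xladder_in ?T' M" "length L'' \<le> length M" using IH by blast
    \<comment> \<open>The second component of \<open>(q, p)\<close> is \<open>p\<close>, which
      commutes with itself, so \<open>(p, q)\<close> may precede this pair. The two pairs replace
      \<open>(g, h)\<close> and the dropped one.\<close>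
    have "xladder_in {t \<in> T. p = t \<or> E p t} ((q, p) # M)"
      using pq xT xX E_sym M(1) by (intro xladder_in_extend[of q p _ ?T']) auto
    from xladder_in_extend[OF _ _ _ _ this order.refl, of q]
    have "xladder_in T ((p, q) # (q, p) # M)" using pq xT xX by blast
    moreover have "Suc (length L) \<le> length ((p, q) # (q, p) # M)" using L''(2) M(2) by simp
    ultimately show ?thesis by blast
  next
    case False
    \<comment> \<open>Otherwise \<open>cl x\<close> would commute with the whole parabolic subgroup,
      in particular with \<open>k\<close>.\<close>
    have "\<exists>p\<in>supp x. \<exists>t\<in>T. p \<noteq> t \<and> \<not> E p t"
    proof (rule ccontr)
      assume *: "\<not> ?thesis"
      obtain v where v: "supp v \<subseteq> T" "k = cl v" using k(1) by (auto simp: parabolic_def)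
      then have "k \<in> centraliser G {cl x}"
        using * xX T commuting_supports[of x v] by blast
      then show False using k(2) by simp
    qed
    then obtain p t where pt: "p \<in> supp x" "t \<in> T" "p \<noteq> t" "\<not> E p t" by blast
    let ?T' = "{s \<in> T. p = s \<or> E p s}"
    have "snd q \<in> parabolic ?T'" if "q \<in> set (map F L)" for q
    proof (rule centraliser_cyclic_clique[OF xX cx(2) par(2)[OF that] comm[OF that] T xT pt(1)])
      show "E p y" if "y \<in> supp x" "y \<noteq> p" for y
        using False pt(1) that by metis
    qed
    then have "gladder_in ?T' (map F L)" using Lc unfolding gladder_in_def by blast
    moreover have "?T' \<subset> T" using pt by blast
    ultimately obtain M where M: "xladder_in ?T' M" "length (map F L) \<le> length M" using IH by blast
    have "xladder_in T ((p, t) # M)"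
      using xladder_in_extend[OF _ _ _ _ M(1) order.refl, of t] pt xX by blast
    moreover have "Suc (length L) \<le> length ((p, t) # M)" using M(2) by simp
    ultimately show ?thesis by blast
  qed
qed

lemma ladder_reduction:
  assumes "finite X" "T \<subseteq> X" "gladder_in T L"
  shows "\<exists>M. xladder_in T M \<and> length L \<le> length M"
  using assms(2,3)
proof (induction "card T" arbitrary: T L rule: less_induct)
  case less
  note T = less.prems(1)
  have IH: "\<exists>M. xladder_in T' M \<and> length L' \<le> length M" if "T' \<subset> T" "gladder_in T' L'" for T' L'
    using less.hyps[of T' L'] that T finite_subset[OF T assms(1)] psubset_card_mono by blast
  show ?case
  proof (cases L)
    case Nil
    then have "xladder_in T [] \<and> length L \<le> length []" by (simp add: xladder_in_def)
    then show ?thesis by blast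
  next
    case (Cons p R)
    obtain g h where gh: "p = (g, h)" by (cases p)
    have gc: "g \<in> carrier G" and hp: "h \<in> parabolic T" and hn: "h \<notin> centraliser G {g}"
      and R: "gladder_in T R" and comm: "\<And>q. q \<in> set R \<Longrightarrow> snd q \<in> centraliser G {g}"
      using less.prems(2) by (auto simp: Cons gh gladder_in_Cons)
    have Rpar: "snd q \<in> parabolic T" if "q \<in> set R" for q using R that by (auto simp: gladder_in_def)
    obtain a u where a: "a \<in> parabolic T"
      and con: "\<And>k. k \<in> parabolic T \<Longrightarrow> k \<in> centraliser G {g} \<Longrightarrow>
         G.conj_by a k \<in> parabolic {t \<in> T. \<forall>y\<in>supp u. E t y}"
      and uX: "supp u \<subseteq> X" and left: "\<And>l. left l u \<Longrightarrow> fst l \<notin> T"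
      and d_ex: "\<exists>d\<in>parabolic T. g = a \<otimes>\<^bsub>G\<^esub> cl u \<otimes>\<^bsub>G\<^esub> d \<otimes>\<^bsub>G\<^esub> inv\<^bsub>G\<^esub> a"
      using parabolic_centraliser_reduction[OF T gc] by blast
    have ac: "a \<in> carrier G" using a parabolic_subset[OF T] by blast
    show ?thesis
    proof (cases "\<exists>t\<in>T. \<exists>y\<in>supp u. \<not> E t y")
      case True
      \<comment> \<open>If adjacency failed only for \<open>t = y\<close>, the first occurrence of
        \<open>t\<close> in \<open>u\<close> could be moved to the front, but no first letter of
        \<open>u\<close> lies over \<open>T\<close>.\<close>
      have "\<exists>t\<in>T. \<exists>y\<in>supp u. t \<noteq> y \<and> \<not> E t y"
      proof (rule ccontr)
        assume *: "\<not> ?thesis"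
        then obtain t where t: "t \<in> T" "t \<in> supp u" using True by metis
        then have "\<exists>l\<in>set u. fst l = t" by (auto simp: supp_def)
        from split_list_first_prop[OF this] obtain p l q where
          u: "u = p @ l # q" "fst l = t" "\<forall>l\<in>set p. fst l \<noteq> t" by blast
        have "E t y" if "y \<in> supp p" for y
        proof -
          have "y \<in> supp u" "t \<noteq> y" using that u by (auto simp: supp_def)
          then show ?thesis using * t(1) by metis
        qed
        then have "left l u" using u by (auto simp: left_iff)
        then show False using left t(1) u(2) by blast
      qed
      then obtain t y where ty: "t \<in> T" "y \<in> supp u" "t \<noteq> y" "\<not> E t y" by blast
      let ?T' = "{s \<in> T. y = s \<or> E y s}"
      have "parabolic {t \<in> T. \<forall>y\<in>supp u. E t y} \<subseteq> parabolic ?T'"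
        using ty(2) E_sym by (intro parabolic_mono) blast
      then have "\<forall>q\<in>set R. G.conj_by a (snd q) \<in> parabolic ?T'" using con Rpar comm by blast
      from gladder_in_conj[OF R T ac this]
      obtain M where M: "xladder_in ?T' M" "length R \<le> length M"
        using IH[of ?T'] ty E_sym by fastforce
      have "xladder_in T ((y, t) # M)"
        using xladder_in_extend[OF _ _ _ _ M(1) order.refl, of t] ty uX E_sym by blast
      moreover have "length L \<le> length ((y, t) # M)" using M(2) Cons by simp
      ultimately show ?thesis by blast
    next
      case False
      obtain d where d: "d \<in> parabolic T" "g = a \<otimes>\<^bsub>G\<^esub> cl u \<otimes>\<^bsub>G\<^esub> d \<otimes>\<^bsub>G\<^esub> inv\<^bsub>G\<^esub> a" using d_ex by blast
      have dc: "d \<in> carrier G" using d(1) parabolic_subset[OF T] by blast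
      have uc: "cl u \<in> carrier G" using uX by simp
      have u_comm: "k \<in> centraliser G {cl u}" if "k \<in> parabolic T" for k
      proof -
        from that obtain v where "supp v \<subseteq> T" "k = cl v" by (auto simp: parabolic_def)
        then show ?thesis using False uX T E_sym commuting_supports[of u v] by blast
      qed
      \<comment> \<open>Here \<open>cl u\<close> commutes with the whole parabolic subgroup.
        Dropping it from \<open>g\<close> leaves an element of that subgroup with the same
        centraliser in it.\<close>
      define g' where "g' = a \<otimes>\<^bsub>G\<^esub> d \<otimes>\<^bsub>G\<^esub> inv\<^bsub>G\<^esub> a"
      have g': "g' \<in> parabolic T" "g' \<in> carrier G"
        unfolding g'_def using a d(1) ac dc subgroup_parabolic[OF T]
        by (auto intro: subgroup.m_closed subgroup.m_inv_closed)
      have "a \<otimes>\<^bsub>G\<^esub> cl u = cl u \<otimes>\<^bsub>G\<^esub> a" using u_comm[OF a] uc by (simp add: G.centraliser_iff)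
      then have g: "g = cl u \<otimes>\<^bsub>G\<^esub> g'" using d(2) ac dc uc by (simp add: g'_def G.m_assoc)
      have iff: "k \<in> centraliser G {g} \<longleftrightarrow> k \<in> centraliser G {g'}" if "k \<in> parabolic T" for k
      proof -
        have kc: "k \<in> carrier G" using that parabolic_subset[OF T] by blast
        have "k \<otimes>\<^bsub>G\<^esub> cl u = cl u \<otimes>\<^bsub>G\<^esub> k" using u_comm[OF that] uc by (simp add: G.centraliser_iff)
        then have "k \<otimes>\<^bsub>G\<^esub> g = cl u \<otimes>\<^bsub>G\<^esub> (k \<otimes>\<^bsub>G\<^esub> g')"
          unfolding g using kc uc g'(2) by (metis G.m_assoc)
        moreover have "g \<otimes>\<^bsub>G\<^esub> k = cl u \<otimes>\<^bsub>G\<^esub> (g' \<otimes>\<^bsub>G\<^esub> k)" unfolding g using kc uc g'(2) by (simp add: G.m_assoc)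
        ultimately show ?thesis using kc uc gc g'(2) by (simp add: G.centraliser_iff)
      qed
      have "gladder_in T ((g', h) # R)"
        using R g' hp hn comm Rpar iff by (simp add: gladder_in_Cons)
      from ladder_reduction_parabolic[OF T IH this g'(1)] show ?thesis by (simp add: Cons)
    qed
  qed
qed

section \<open>Passage between chains and ladders, and the height of the lattice\<close>

lemma chain_ladder:
  assumes "centraliser_chain G C k"
  shows "\<exists>L. gladder_in X L \<and> length L = k"
proof -
  have "\<forall>i\<le>k. \<exists>S. S \<subseteq> carrier G \<and> C i = centraliser G S"
    using assms by (simp add: centraliser_chain_def is_centraliser_def)
  then obtain S where S: "\<And>i. i \<le> k \<Longrightarrow> S i \<subseteq> carrier G \<and> C i = centraliser G (S i)" by metis
  have strict: "C (Suc i) \<subset> C i" if "i < k" for i using assms that by (simp add: centraliser_chain_def)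
  have mono: "C j \<subseteq> C i" if "i \<le> j" "j \<le> k" for i j
    using that
  proof (induction j rule: dec_induct)
    case (step j)
    then show ?case using strict[of j] by auto
  qed simp
  \<comment> \<open>The element \<open>h\<close> witnesses strictness of the inclusion, and
    \<open>f\<close> is a member of \<open>S (Suc i)\<close> with which it fails to commute.\<close>
  have "\<exists>f h. f \<in> S (Suc i) \<and> h \<in> C i \<and> h \<notin> centraliser G {f}" if i: "i < k" for i
  proof -
    obtain h where "h \<in> C i" "h \<notin> C (Suc i)" using strict[OF i] by blast
    moreover have "h \<in> carrier G" using \<open>h \<in> C i\<close> S[of i] i centraliser_pointwise[of h G "S i"] by simp
    ultimately show ?thesis
      using S[of "Suc i"] i centraliser_pointwise[of h G "S (Suc i)"] by auto
  qed
  then obtain f h where fh: "\<And>i. i < k \<Longrightarrow> f i \<in> S (Suc i) \<and> h i \<in> C i \<and> h i \<notin> centraliser G {f i}"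
    by metis
  have comm: "h j \<in> centraliser G {f i}" if "i < j" "j < k" for i j
  proof -
    have "h j \<in> C (Suc i)" using fh[of j] mono[of "Suc i" j] that by auto
    then show ?thesis
      using S[of "Suc i"] fh[of i] that centraliser_pointwise[of "h j" G "S (Suc i)"] by auto
  qed
  have car: "f i \<in> carrier G" "h i \<in> carrier G" if "i < k" for i
    using fh[OF that] S[of "Suc i"] S[of i] that centraliser_pointwise[of "h i" G "S i"] by auto
  have "gladder_in X (map (\<lambda>i. (f i, h i)) [0..<k])"
    using fh comm car by (auto simp: gladder_in_def ladder_nth parabolic_carrier)
  then show ?thesis by (intro exI[of _ "map (\<lambda>i. (f i, h i)) [0..<k]"]) simp
qed

definition canonical_chain :: "(nat \<Rightarrow> 'a set) \<Rightarrow> nat \<Rightarrow> bool" where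
  "canonical_chain Y m \<longleftrightarrow> (\<forall>i\<le>m. Y i \<subseteq> X) \<and>
     (\<forall>i<m. centraliser G (gen ` Y (Suc i)) \<subset> centraliser G (gen ` Y i))"

lemma canonical_chain_centraliser_chain:
  assumes "canonical_chain Y m"
  shows "centraliser_chain G (\<lambda>i. centraliser G (gen ` Y i)) m"
  unfolding centraliser_chain_def
proof (intro conjI allI impI)
  fix i assume "i \<le> m"
  then have "gen ` Y i \<subseteq> carrier G" using assms gen_closed by (auto simp: canonical_chain_def)
  then show "is_centraliser G (centraliser G (gen ` Y i))" unfolding is_centraliser_def by blast
qed (use assms in \<open>simp add: canonical_chain_def\<close>)

text \<open>The sets \<open>Y i\<close> collect the first components of the first \<open>i\<close>
  pairs. The next second component commutes with all of them but not with the next first component,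
  so each inclusion is strict.\<close>

lemma xladder_canonical_chain:
  assumes "xladder_in X M"
  shows "\<exists>Y. canonical_chain Y (length M)"
proof -
  define Y where "Y = (\<lambda>i. fst ` set (take i M))"
  have YX: "Y i \<subseteq> X" for i
    using assms set_take_subset[of i M] by (auto simp: xladder_in_def Y_def)
  have "centraliser G (gen ` Y (Suc i)) \<subset> centraliser G (gen ` Y i)" if i: "i < length M" for i
  proof -
    have in_X: "fst (M ! j) \<in> X" "snd (M ! j) \<in> X" if "j < length M" for j
      using assms that by (auto simp: xladder_in_def)
    have Y_Suc: "Y (Suc i) = insert (fst (M ! i)) (Y i)"
      using i by (simp add: Y_def take_Suc_conv_app_nth)
    have lad: "xladder M" using assms by (simp add: xladder_in_def)
    let ?h = "gen (snd (M ! i))"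
    have "?h \<in> centraliser G {gen y}" if y: "y \<in> Y i" for y
    proof -
      obtain j where "j < i" "y = fst (M ! j)" using y i by (auto simp: Y_def in_set_conv_nth)
      then show ?thesis using lad i in_X gen_commute_iff[of y "snd (M ! i)"] by (auto simp: ladder_nth)
    qed
    then have "?h \<in> centraliser G (gen ` Y i)"
      using gen_closed in_X(2)[OF i] centraliser_pointwise[of ?h G "gen ` Y i"] by auto
    moreover have "?h \<notin> centraliser G {gen (fst (M ! i))}"
      using lad i in_X gen_commute_iff[of "fst (M ! i)" "snd (M ! i)"] by (auto simp: ladder_nth)
    then have "?h \<notin> centraliser G (gen ` Y (Suc i))"
      unfolding Y_Suc centraliser_pointwise[of ?h G "gen ` insert _ _"] by blast
    moreover have "centraliser G (gen ` Y (Suc i)) \<subseteq> centraliser G (gen ` Y i)"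
      by (auto simp: centraliser_def Y_Suc)
    ultimately show ?thesis by blast
  qed
  then show ?thesis using YX unfolding canonical_chain_def by blast
qed

text \<open>First components are distinct: an earlier one commutes with the second component of a
  later pair, whose own first component does not. This bound provides a longest ladder of
  generators.\<close>

lemma xladder_length:
  assumes "finite X" "xladder_in X M"
  shows "length M \<le> card X"
proof -
  have "distinct (map fst M)"
    unfolding distinct_conv_nth
  proof (intro allI impI)
    have ne: "map fst M ! i \<noteq> map fst M ! j" if "i < j" "j < length M" for i j
    proof
      assume eq: "map fst M ! i = map fst M ! j"
      have "fst (M ! i) = snd (M ! j) \<or> E (fst (M ! i)) (snd (M ! j))"
        "\<not> (fst (M ! j) = snd (M ! j) \<or> E (fst (M ! j)) (snd (M ! j)))"
        using assms(2) that unfolding xladder_in_def ladder_nth by blast+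
      then show False using eq that by simp
    qed
    fix i j assume "i < length (map fst M)" "j < length (map fst M)" "i \<noteq> j"
    then show "map fst M ! i \<noteq> map fst M ! j" using ne[of i j] ne[of j i] by (cases "i < j") auto
  qed
  then have "length M = card (fst ` set M)" using distinct_card by fastforce
  also have "\<dots> \<le> card X" using assms by (intro card_mono) (auto simp: xladder_in_def)
  finally show ?thesis .
qed

lemma cdim_canonical:
  assumes "finite X"
  shows "\<exists>k. cdim G = enat k \<and> (\<exists>Y. canonical_chain Y k) \<and> (\<forall>m Y. canonical_chain Y m \<longrightarrow> m \<le> k)"
proof -
  \<comment> \<open>The height is the greatest length of a ladder of generators. It is attained by a
    canonical chain and, by \<open>ladder_reduction\<close>, bounds every centraliser chain.\<close>
  define K where "K = length ` {M. xladder_in X M}"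
  have "K \<subseteq> {..card X}" using xladder_length[OF assms] by (auto simp: K_def)
  then have fin: "finite K" using finite_subset by blast
  have "xladder_in X []" by (simp add: xladder_in_def)
  then have "K \<noteq> {}" unfolding K_def by blast
  then have "Max K \<in> K" by (rule Max_in[OF fin])
  then obtain M where M: "xladder_in X M" "length M = Max K" by (auto simp: K_def)
  then obtain Y where Y: "canonical_chain Y (Max K)" using xladder_canonical_chain by metis
  have chain_le: "k \<le> Max K" if "centraliser_chain G C k" for C k
  proof -
    from chain_ladder[OF that] obtain L where "gladder_in X L" "length L = k" by blast
    then obtain M where "xladder_in X M" "k \<le> length M" using ladder_reduction[OF assms] by blast
    then have "length M \<le> Max K" using Max_ge[OF fin] by (auto simp: K_def)
    then show ?thesis using \<open>k \<le> length M\<close> by simp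
  qed
  have "cdim G = enat (Max K)"
  proof (rule antisym)
    show "cdim G \<le> enat (Max K)" unfolding cdim_def using chain_le by (intro Sup_least) auto
    show "enat (Max K) \<le> cdim G"
      unfolding cdim_def using canonical_chain_centraliser_chain[OF Y] by (intro Sup_upper) blast
  qed
  then show ?thesis using Y chain_le canonical_chain_centraliser_chain by blast
qed

end

theorem theorem3p3:
  fixes X :: "'a set" and E :: "'a \<Rightarrow> 'a \<Rightarrow> bool"
  assumes "finite X"
    and "\<And>x y. E x y \<Longrightarrow> x \<in> X \<and> y \<in> X"
    and "\<And>x y. E x y \<Longrightarrow> E y x"
    and "\<And>x. \<not> E x x"
  shows "\<exists>k::nat. cdim (pc_group X E) = enat k
     \<and> (\<exists>Y :: nat \<Rightarrow> 'a set. (\<forall>i\<le>k. Y i \<subseteq> X) \<and>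
          (\<forall>i<k. centraliser (pc_group X E) (pc_gen X E ` Y (Suc i))
                  \<subset> centraliser (pc_group X E) (pc_gen X E ` Y i)))
     \<and> (\<forall>(m::nat) (Y :: nat \<Rightarrow> 'a set). (\<forall>i\<le>m. Y i \<subseteq> X) \<and>
          (\<forall>i<m. centraliser (pc_group X E) (pc_gen X E ` Y (Suc i))
                  \<subset> centraliser (pc_group X E) (pc_gen X E ` Y i)) \<longrightarrow> m \<le> k)"
proof -
  interpret pc_graph X E using assms(2-4) by unfold_locales auto
  show ?thesis using cdim_canonical[OF assms(1)] unfolding canonical_chain_def .
qed

end
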